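(* Let $l\geq 5$ be an integer. Assuming the Exponential Time Hypothesis, there is no algorithm that solves $C_l$-Vertex Deletion in time $2^{o(p^2)}|G|^{O(1)}$, and there is no algorithm that solves Girth $>l$ Vertex Deletion in time $2^{o(p^2)}|G|^{O(1)}$, where $p$ denotes the width of a path decomposition of the input graph $G$ given together with the input.
   Context: $|G|=|V(G)|+|E(G)|$. A path decomposition of a graph $G$ is a sequence of bags $B_1,\dots,B_r\subseteq V(G)$ such that every vertex lies in some bag, every edge has both endpoints in some bag, and for each vertex the indices of the bags containing it form an interval; its width is the maximum bag size minus one. $C_l$-Vertex Deletion: given an undirected graph $G$ and an integer $k$, decide whether one can remove at most $k$ vertices from $G$ so that the remaining vertices induce a graph with no cycle of length exactly $l$. Girth $>l$ Vertex Deletion: given an undirected graph $G$ and an integer $k$, decide whether one can remove at most $k$ vertices from $G$ so that the remaining vertices induce a graph with no cycle of length at most $l$. Exponential Time Hypothesis (ETH): the infimum of the constants $c$ such that 3CNF-SAT on $n$ variables can be solved in time $c^n$ is greater than $1$ (equivalently, 3CNF-SAT cannot be solved in time $2^{o(n)}$). *)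

theory Defs
  imports Complex_Main "HOL-Library.Landau_Symbols"
begin

section \<open>Machine model\<close>

text \<open>
  Algorithms are while programs over binary trees with unit cost per elementary step (the language
  WHILE of N. D. Jones, \<^emph>\<open>Computability and Complexity from a Programming Perspective\<close>, in
  three-address form). Every instruction creates at most one tree node, follows one pointer, or tests
  one pointer for \<open>Lf\<close>; there is no structural equality test. Keeping trees as shared pointer
  structures, \<open>t\<close> steps are simulated by a Turing machine in time polynomial in \<open>t\<close> and the size
  of the input, and conversely. All running times below are closed under polynomial slow-down (of
  the form \<open>2 ^ o(p ^ 2) * |G| ^ O(1)\<close>, or \<open>c ^ n\<close> times a polynomial with the question being
  whether the infimum over \<open>c\<close> is 1), so they do not depend on the choice between this model and
  Turing machines or RAMs.
\<close>

datatype bintree = Lf | Br bintree bintree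

primrec left :: "bintree \<Rightarrow> bintree" where
  "left Lf = Lf"
| "left (Br a b) = a"

primrec right :: "bintree \<Rightarrow> bintree" where
  "right Lf = Lf"
| "right (Br a b) = b"

type_synonym vname = nat
type_synonym store = "vname \<Rightarrow> bintree"

datatype exp = Empty | Var vname | Pair vname vname | Left vname | Right vname

primrec eval_exp :: "exp \<Rightarrow> store \<Rightarrow> bintree" where
  "eval_exp Empty s = Lf"
| "eval_exp (Var x) s = s x"
| "eval_exp (Pair x y) s = Br (s x) (s y)"
| "eval_exp (Left x) s = left (s x)"
| "eval_exp (Right x) s = right (s x)"

datatype com = Assign vname exp | Seq com com | If vname com com | While vname com

text \<open>\<open>run c s t s'\<close>: started in store \<open>s\<close>, the program \<open>c\<close> halts after \<open>t\<close> steps in \<open>s'\<close>.\<close>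

inductive run :: "com \<Rightarrow> store \<Rightarrow> nat \<Rightarrow> store \<Rightarrow> bool" where
  Assign: "run (Assign x e) s 1 (s(x := eval_exp e s))"
| Seq: "run c s m s' \<Longrightarrow> run d s' n s'' \<Longrightarrow> run (Seq c d) s (m + n) s''"
| IfTrue: "s x \<noteq> Lf \<Longrightarrow> run c s n s' \<Longrightarrow> run (If x c d) s (n + 1) s'"
| IfFalse: "s x = Lf \<Longrightarrow> run d s n s' \<Longrightarrow> run (If x c d) s (n + 1) s'"
| WhileFalse: "s x = Lf \<Longrightarrow> run (While x c) s 1 s"
| WhileTrue: "s x \<noteq> Lf \<Longrightarrow> run c s m s' \<Longrightarrow> run (While x c) s' n s''
    \<Longrightarrow> run (While x c) s (m + n + 1) s''"

inductive_cases AssignE: "run (Assign x e) s t s'"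
inductive_cases SeqE: "run (Seq c d) s t s'"
inductive_cases IfE: "run (If x c d) s t s'"
inductive_cases WhileE: "run (While x c) s t s'"

lemma run_deterministic:
  "run c s t s' \<Longrightarrow> run c s u s'' \<Longrightarrow> t = u \<and> s' = s''"
proof (induction arbitrary: u s'' rule: run.induct)
  case Assign
  from Assign.prems show ?case by (rule AssignE) simp
next
  case (Seq c s m s1 d n s2)
  from Seq.prems obtain m' n' r where "u = m' + n'" "run c s m' r" "run d r n' s''"
    by (rule SeqE)
  with Seq.IH(1)[of m' r] Seq.IH(2)[of n' s''] show ?case by simp
next
  case (IfTrue s x c n s' d)
  from IfTrue.prems IfTrue.hyps(1) obtain n' where "u = n' + 1" "run c s n' s''"
    by (auto elim: IfE)
  with IfTrue.IH[of n' s''] show ?case by simp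
next
  case (IfFalse s x d n s' c)
  from IfFalse.prems IfFalse.hyps(1) obtain n' where "u = n' + 1" "run d s n' s''"
    by (auto elim: IfE)
  with IfFalse.IH[of n' s''] show ?case by simp
next
  case (WhileFalse s x c)
  from WhileFalse.prems WhileFalse.hyps show ?case by (auto elim: WhileE)
next
  case (WhileTrue s x c m s1 n s2)
  from WhileTrue.prems show ?case
  proof (rule WhileE)
    assume "u = Suc 0" "s'' = s" "s x = Lf"
    with WhileTrue.hyps(1) show ?thesis by simp
  next
    fix m' r n'
    assume "u = Suc (m' + n')" "s x \<noteq> Lf" "run c s m' r" "run (While x c) r n' s''"
    with WhileTrue.IH(1)[of m' r] WhileTrue.IH(2)[of n' s''] show ?thesis by simp
  qed
qed

definition init :: "bintree \<Rightarrow> store" where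
  "init a = (\<lambda>x. if x = 0 then a else Lf)"

text \<open>
  \<open>P\<close> decides the problem with instances \<open>I\<close> (presented through \<open>enc\<close>) and yes-instances given
  by \<open>yes\<close>, using at most \<open>T x\<close> steps on \<open>x\<close>. Input and output are in variable 0; any output
  other than \<open>Lf\<close> means yes. Nothing is required of \<open>P\<close> on trees that encode no instance.
\<close>

definition solves_in_time ::
  "com \<Rightarrow> ('i \<Rightarrow> bintree) \<Rightarrow> 'i set \<Rightarrow> ('i \<Rightarrow> bool) \<Rightarrow> ('i \<Rightarrow> real) \<Rightarrow> bool" where
  "solves_in_time P enc I yes T \<longleftrightarrow>
     (\<forall>x\<in>I. \<exists>t s. run P (init (enc x)) t s \<and> real t \<le> T x \<and> (s 0 \<noteq> Lf \<longleftrightarrow> yes x))"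


section \<open>Encodings\<close>

text \<open>
  Numbers are written in unary. Every number occurring in an instance is polynomially bounded in the
  quantity measuring the instance, except the deletion budget, and a budget exceeding the number of
  vertices is as good as that number; hence a binary encoding would give the same notions.
\<close>

primrec enc_list :: "bintree list \<Rightarrow> bintree" where
  "enc_list [] = Lf"
| "enc_list (a # as) = Br a (enc_list as)"

definition enc_nat :: "nat \<Rightarrow> bintree" where
  "enc_nat n = enc_list (replicate n Lf)"

definition enc_bool :: "bool \<Rightarrow> bintree" where
  "enc_bool b = (if b then Br Lf Lf else Lf)"

definition enc_int :: "int \<Rightarrow> bintree" where
  "enc_int k = Br (enc_bool (k < 0)) (enc_nat (nat \<bar>k\<bar>))"


section \<open>3CNF-SAT and the Exponential Time Hypothesis\<close>

text \<open>
  The three literals of a clause need not be distinct. A literal is a variable with its sign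
  (\<open>True\<close> for a positive literal). A formula on \<open>n\<close> variables uses the variables \<open>0, \<dots>, n - 1\<close>.
\<close>

type_synonym literal = "nat \<times> bool"
type_synonym clause = "literal \<times> literal \<times> literal"
type_synonym cnf3 = "nat \<times> clause list"

definition valid_cnf3 :: "cnf3 \<Rightarrow> bool" where
  "valid_cnf3 = (\<lambda>(n, cs). \<forall>((u, a), (v, b), (w, c)) \<in> set cs. u < n \<and> v < n \<and> w < n)"

definition satisfiable_cnf3 :: "cnf3 \<Rightarrow> bool" where
  "satisfiable_cnf3 = (\<lambda>(n, cs). \<exists>\<sigma> :: nat \<Rightarrow> bool.
     \<forall>((u, a), (v, b), (w, c)) \<in> set cs. \<sigma> u = a \<or> \<sigma> v = b \<or> \<sigma> w = c)"

definition enc_literal :: "literal \<Rightarrow> bintree" where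
  "enc_literal = (\<lambda>(v, a). Br (enc_nat v) (enc_bool a))"

definition enc_clause :: "clause \<Rightarrow> bintree" where
  "enc_clause = (\<lambda>(x, y, z). enc_list [enc_literal x, enc_literal y, enc_literal z])"

definition enc_cnf3 :: "cnf3 \<Rightarrow> bintree" where
  "enc_cnf3 = (\<lambda>(n, cs). Br (enc_nat n) (enc_list (map enc_clause cs)))"

text \<open>
  Time \<open>c ^ n\<close> is understood up to a factor polynomial in the length of the formula: a clause may be
  repeated any number of times, so no bound depending on \<open>n\<close> alone makes sense.
\<close>

definition sat3_exponential_base :: "real \<Rightarrow> bool" where
  "sat3_exponential_base c \<longleftrightarrow>
     (\<exists>P (C :: real) (d :: nat).
        solves_in_time P enc_cnf3 {\<phi>. valid_cnf3 \<phi>} satisfiable_cnf3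
          (\<lambda>(n, cs). C * c ^ n * real (n + length cs + 1) ^ d))"

definition ETH :: bool where
  "ETH \<longleftrightarrow> Inf {c :: real. 0 < c \<and> sat3_exponential_base c} > 1"


section \<open>Graphs\<close>

text \<open>A finite simple undirected graph is given by its vertex set \<open>V\<close> and its set \<open>E\<close> of edges,
  which are two-element subsets of \<open>V\<close>.\<close>

definition simple_graph :: "'a set \<Rightarrow> 'a set set \<Rightarrow> bool" where
  "simple_graph V E \<longleftrightarrow> finite V \<and> (\<forall>e\<in>E. e \<subseteq> V \<and> card e = 2)"

definition graph_size :: "'a set \<Rightarrow> 'a set set \<Rightarrow> nat" where
  "graph_size V E = card V + card E"

definition induced_edges :: "'a set set \<Rightarrow> 'a set \<Rightarrow> 'a set set" where
  "induced_edges E W = {e\<in>E. e \<subseteq> W}"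

text \<open>A cycle is listed by its vertices in cyclic order.\<close>

definition is_cycle :: "'a set set \<Rightarrow> 'a list \<Rightarrow> bool" where
  "is_cycle E vs \<longleftrightarrow> 3 \<le> length vs \<and> distinct vs \<and>
     (\<forall>i<length vs. {vs ! i, vs ! (Suc i mod length vs)} \<in> E)"

definition cycle_vertex_deletion :: "nat \<Rightarrow> 'a set \<Rightarrow> 'a set set \<Rightarrow> int \<Rightarrow> bool" where
  "cycle_vertex_deletion l V E k \<longleftrightarrow>
     (\<exists>S\<subseteq>V. int (card S) \<le> k \<and>
        \<not> (\<exists>vs. is_cycle (induced_edges E (V - S)) vs \<and> length vs = l))"

definition girth_vertex_deletion :: "nat \<Rightarrow> 'a set \<Rightarrow> 'a set set \<Rightarrow> int \<Rightarrow> bool" where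
  "girth_vertex_deletion l V E k \<longleftrightarrow>
     (\<exists>S\<subseteq>V. int (card S) \<le> k \<and>
        \<not> (\<exists>vs. is_cycle (induced_edges E (V - S)) vs \<and> length vs \<le> l))"

definition path_decomposition :: "'a set \<Rightarrow> 'a set set \<Rightarrow> 'a set list \<Rightarrow> bool" where
  "path_decomposition V E Bs \<longleftrightarrow>
     Bs \<noteq> [] \<and>
     (\<forall>B\<in>set Bs. B \<subseteq> V) \<and>
     (\<forall>v\<in>V. \<exists>B\<in>set Bs. v \<in> B) \<and>
     (\<forall>e\<in>E. \<exists>B\<in>set Bs. e \<subseteq> B) \<and>
     (\<forall>v\<in>V. \<forall>i j k. i \<le> j \<longrightarrow> j \<le> k \<longrightarrow> k < length Bs \<longrightarrow> v \<in> Bs ! i \<longrightarrow> v \<in> Bs ! k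
        \<longrightarrow> v \<in> Bs ! j)"

text \<open>Truncated subtraction: the width is 0 instead of -1 if all bags are empty, which happens only
  for the graph without vertices.\<close>

definition pd_width :: "'a set list \<Rightarrow> nat" where
  "pd_width Bs = Max (card ` set Bs) - 1"


section \<open>Deletion problems parameterized by the width of a given path decomposition\<close>

text \<open>
  An instance \<open>(n, es, k, bs)\<close> consists of the graph with vertices \<open>0, \<dots>, n - 1\<close> and edge list
  \<open>es\<close>, the integer \<open>k\<close>, and the list \<open>bs\<close> of bags of a path decomposition. Edges and the elements
  of each bag are listed without repetition, in any order.
\<close>

type_synonym pd_instance = "nat \<times> (nat \<times> nat) list \<times> int \<times> nat list list"

definition edges_of :: "(nat \<times> nat) list \<Rightarrow> nat set set" where
  "edges_of es = (\<lambda>(u, v). {u, v}) ` set es"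

definition valid_pd_instance :: "pd_instance \<Rightarrow> bool" where
  "valid_pd_instance = (\<lambda>(n, es, k, bs).
     distinct es \<and> (\<forall>(u, v)\<in>set es. u < v \<and> v < n) \<and> (\<forall>b\<in>set bs. distinct b) \<and>
     path_decomposition {..<n} (edges_of es) (map set bs))"

lemma valid_pd_instance_simple_graph:
  assumes "valid_pd_instance (n, es, k, bs)"
  shows "simple_graph {..<n} (edges_of es)"
proof -
  have "u < n \<and> v < n \<and> card {u, v} = 2" if "(u, v) \<in> set es" for u v
  proof -
    from assms that have "u < v" "v < n"
      unfolding valid_pd_instance_def by auto
    then show ?thesis by simp
  qed
  then show ?thesis
    unfolding simple_graph_def edges_of_def by auto
qed

definition enc_pd_instance :: "pd_instance \<Rightarrow> bintree" where
  "enc_pd_instance = (\<lambda>(n, es, k, bs). enc_list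
     [enc_nat n,
      enc_list (map (\<lambda>(u, v). Br (enc_nat u) (enc_nat v)) es),
      enc_int k,
      enc_list (map (\<lambda>b. enc_list (map enc_nat b)) bs)])"

text \<open>
  The running time \<open>2 ^ o(p ^ 2) * |G| ^ O(1)\<close>. The base is \<open>|G| + 1\<close> because \<open>|G|\<close> is 0 for the
  graph without vertices, and a bound vanishing there could not be met by any program.
\<close>

definition solvable_in_subexp_pd_time ::
  "(nat set \<Rightarrow> nat set set \<Rightarrow> int \<Rightarrow> bool) \<Rightarrow> bool" where
  "solvable_in_subexp_pd_time problem \<longleftrightarrow>
     (\<exists>P (f :: nat \<Rightarrow> real) (C :: real) (d :: nat).
        f \<in> o(\<lambda>p. real p ^ 2) \<and>
        solves_in_time P enc_pd_instance {x. valid_pd_instance x}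
          (\<lambda>(n, es, k, bs). problem {..<n} (edges_of es) k)
          (\<lambda>(n, es, k, bs). C * 2 powr f (pd_width (map set bs)) *
             real (graph_size {..<n} (edges_of es) + 1) ^ d))"

end

theory Submission
  imports Defs "HOL-Library.Nat_Bijection"
begin

text \<open>
  A 3CNF formula on \<open>n\<close> variables is reduced in polynomial time to a graph of pathwidth
  \<open>O(sqrt n)\<close>, independently of the number of clauses, so that no sparsification is needed. The
  \<open>2 n\<close> literals are mapped to distinct pairs \<open>(i, j)\<close> with \<open>i, j = O(sqrt n)\<close>, and the core vertices
  \<open>U i\<close> and \<open>W j\<close> lie in all bags. A variable gadget has one path of length
  \<open>a = (l - 1) div 2\<close> between \<open>U i\<close> and \<open>W j\<close> for each of the two literals, and a clause gadget one
  path of length \<open>b = l - a\<close> for each of its three literals. Any two paths of the same gadget meet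
  a private cycle of length \<open>l\<close> in their first inner vertices, so the budget \<open>n + 2 m\<close> forces
  exactly one deletion in every variable gadget and two in every clause gadget. Some path of each
  clause survives; together with the variable path of the same literal it would form a cycle of
  length \<open>a + b = l\<close>, so the latter path is destroyed, which encodes that the literal is true.
  Conversely, a satisfying assignment leaves no cycle of length at most \<open>l\<close>: surviving paths
  between the same two core vertices all have length \<open>b\<close>, and \<open>2 b > l\<close> and \<open>4 a > l\<close>. Hence
  a single reduction serves both problems.
\<close>


section \<open>Polynomial-time functions on binary trees\<close>

text \<open>The gain lies in the core: \<open>O(p)\<close> vertices in every bag offer about
  \<open>p ^ 2\<close> pairs, and a pair is all that a literal needs to link its variable to its
  clauses. Thus \<open>p ^ 2 = O(n)\<close>, and time \<open>2 ^ o(p ^ 2)\<close> turns into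
  \<open>2 ^ o(n)\<close>. The two path lengths must differ. A literal may be the chosen true one in
  many clauses, so parallel clause paths have to be allowed to survive together, and only a variable
  path may complete the forbidden length \<open>l\<close> with one of them. All other cycles
  alternate between the \<open>U\<close> side and the \<open>W\<close> side and use at least four
  paths. A deletion in the core would destroy many cycles at once; the tight budget excludes it,
  because the private cycles already consume every deletion. On the machine side the reduction must
  be an actual program. Subtrees are shared, so few steps can build a huge tree, and sizes have to
  be controlled separately from running times, above all in loops. Since \<open>ETH\<close> speaks
  of an infimum, it is refuted by reaching every base \<open>c > 1\<close>.\<close>

primrec sz :: "bintree \<Rightarrow> nat" where
  "sz Lf = 1"
| "sz (Br x y) = sz x + sz y + 1"

lemma sz_pos [simp]: "0 < sz x" "1 \<le> sz x" "Suc 0 \<le> sz x"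
  by (cases x; simp)+

lemma sz_left_le: "sz (left x) \<le> sz x" and sz_right_le: "sz (right x) \<le> sz x"
  by (cases x; simp)+

text \<open>Leaves count 1, so \<open>sz\<close> is never 0 and lower powers are absorbed by higher
  ones; a single monomial therefore suffices. The function \<open>g\<close> itself need not be
  monotone.\<close>

definition poly_bounded :: "(bintree \<Rightarrow> nat) \<Rightarrow> bool" where
  "poly_bounded g \<longleftrightarrow> (\<exists>K d. \<forall>x. g x \<le> K * sz x ^ d)"

lemma poly_boundedI: "(\<And>x. g x \<le> K * sz x ^ d) \<Longrightarrow> poly_bounded g"
  unfolding poly_bounded_def by blast

lemma poly_bounded_const: "poly_bounded (\<lambda>_. K)"
  by (rule poly_boundedI[of _ K 0]) simp

lemma poly_bounded_sz: "poly_bounded sz"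
  by (rule poly_boundedI[of _ 1 1]) simp

lemma poly_bounded_mono: "poly_bounded g \<Longrightarrow> (\<And>x. h x \<le> g x) \<Longrightarrow> poly_bounded h"
  unfolding poly_bounded_def by (meson order_trans)

lemma poly_bounded_add:
  assumes "poly_bounded g" "poly_bounded h"
  shows "poly_bounded (\<lambda>x. g x + h x)"
proof -
  obtain K d K' d' where g: "\<And>x. g x \<le> K * sz x ^ d" and h: "\<And>x. h x \<le> K' * sz x ^ d'"
    using assms unfolding poly_bounded_def by blast
  have "g x + h x \<le> (K + K') * sz x ^ (d + d')" for x
  proof -
    have "sz x ^ d \<le> sz x ^ (d + d')" "sz x ^ d' \<le> sz x ^ (d + d')"
      by (rule power_increasing; simp)+
    then have "K * sz x ^ d \<le> K * sz x ^ (d + d')" "K' * sz x ^ d' \<le> K' * sz x ^ (d + d')"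
      by (intro mult_left_mono; simp)+
    with g[of x] h[of x] show ?thesis by (simp only: add_mult_distrib)
  qed
  then show ?thesis by (rule poly_boundedI)
qed

lemma poly_bounded_mult:
  assumes "poly_bounded g" "poly_bounded h"
  shows "poly_bounded (\<lambda>x. g x * h x)"
proof -
  obtain K d K' d' where g: "\<And>x. g x \<le> K * sz x ^ d" and h: "\<And>x. h x \<le> K' * sz x ^ d'"
    using assms unfolding poly_bounded_def by blast
  have "g x * h x \<le> (K * K') * sz x ^ (d + d')" for x
    using mult_mono[OF g[of x] h[of x]] by (simp add: power_add algebra_simps)
  then show ?thesis by (rule poly_boundedI)
qed

lemma poly_bounded_power:
  assumes "poly_bounded g"
  shows "poly_bounded (\<lambda>x. g x ^ k)"
  by (induction k) (simp_all add: poly_bounded_const poly_bounded_mult assms)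

lemma poly_bounded_comp:
  assumes "poly_bounded g" "poly_bounded (\<lambda>x. sz (f x))"
  shows "poly_bounded (\<lambda>x. g (f x))"
proof -
  obtain K d where "\<And>x. g x \<le> K * sz x ^ d"
    using assms unfolding poly_bounded_def by blast
  moreover have "poly_bounded (\<lambda>x. K * sz (f x) ^ d)"
    by (intro poly_bounded_mult poly_bounded_power poly_bounded_const assms)
  ultimately show ?thesis by (rule_tac poly_bounded_mono)
qed

lemmas poly_bounded_intros =
  poly_bounded_const poly_bounded_sz poly_bounded_add poly_bounded_mult poly_bounded_power


text \<open>A program for \<open>f\<close> uses the variables \<open>1, \<dots>, N - 1\<close> as scratch space and restores them, so
  that programs compose without renaming: variables from \<open>N\<close> on survive a call.\<close>

definition computes :: "com \<Rightarrow> nat \<Rightarrow> (bintree \<Rightarrow> nat) \<Rightarrow> (bintree \<Rightarrow> bintree) \<Rightarrow> bool" where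
  "computes c N T f \<longleftrightarrow> 0 < N \<and> (\<forall>s. (\<forall>i. 0 < i \<longrightarrow> i < N \<longrightarrow> s i = Lf) \<longrightarrow>
     (\<exists>t\<le>T (s 0). run c s t (s(0 := f (s 0)))))"

text \<open>The output size is bounded separately because the running time does not bound it:
  \<open>Pair x x\<close> shares its argument, so \<open>t\<close> steps can build a tree of size
  exponential in \<open>t\<close>.\<close>

definition ptime :: "(bintree \<Rightarrow> bintree) \<Rightarrow> bool" where
  "ptime f \<longleftrightarrow> poly_bounded (\<lambda>x. sz (f x)) \<and> (\<exists>c N T. poly_bounded T \<and> computes c N T f)"

lemma computes_run:
  assumes "computes c N T f" "\<And>i. 0 < i \<Longrightarrow> i < N \<Longrightarrow> s i = Lf" "s' = s(0 := f (s 0))"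
  shows "\<exists>t\<le>T (s 0). run c s t s'"
  using assms unfolding computes_def by blast

lemma computes_weaken: "computes c N T f \<Longrightarrow> N \<le> M \<Longrightarrow> computes c M T f"
  unfolding computes_def by auto

lemma ptime_sz: "ptime f \<Longrightarrow> poly_bounded (\<lambda>x. sz (f x))"
  unfolding ptime_def by blast

lemma ptimeI: "computes c N T f \<Longrightarrow> poly_bounded T \<Longrightarrow> poly_bounded (\<lambda>x. sz (f x)) \<Longrightarrow> ptime f"
  unfolding ptime_def by blast

lemma ptimeE:
  assumes "ptime f"
  obtains c N T where "poly_bounded T" "computes c N T f"
  using assms unfolding ptime_def by blast

section \<open>Closure properties of polynomial-time tree functions\<close>

lemma ptime_assign:
  assumes "\<And>s. eval_exp e s = f (s 0)" "\<And>x. sz (f x) \<le> sz x + 1"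
  shows "ptime f"
proof -
  have "computes (Assign 0 e) 1 (\<lambda>_. 1) f"
    unfolding computes_def using run.Assign[of 0 e] assms(1) by fastforce
  moreover have "poly_bounded (\<lambda>x. sz (f x))"
    by (rule poly_bounded_mono[OF _ assms(2)]) (intro poly_bounded_intros)
  ultimately show ?thesis
    by (rule ptimeI[OF _ poly_bounded_const])
qed

lemma ptime_id: "ptime (\<lambda>x. x)"
  by (rule ptime_assign[of "Var 0"]) simp_all

lemma ptime_Lf: "ptime (\<lambda>x. Lf)"
  by (rule ptime_assign[of "Empty"]) simp_all

lemma ptime_left0: "ptime left"
  by (rule ptime_assign[of "Left 0"]) (simp_all add: sz_left_le le_SucI)

lemma ptime_right0: "ptime right"
  by (rule ptime_assign[of "Right 0"]) (simp_all add: sz_right_le le_SucI)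

lemma ptime_comp:
  assumes "ptime g" "ptime f"
  shows "ptime (\<lambda>x. g (f x))"
proof -
  obtain c N T where f: "poly_bounded T" "computes c N T f"
    by (rule ptimeE[OF assms(2)])
  obtain d M R where g: "poly_bounded R" "computes d M R g"
    by (rule ptimeE[OF assms(1)])
  have f': "computes c (max N M) T f" and g': "computes d (max N M) R g"
    by (rule computes_weaken[OF f(2)] computes_weaken[OF g(2)]; simp)+
  have "computes (Seq c d) (max N M) (\<lambda>x. T x + R (f x)) (\<lambda>x. g (f x))"
    unfolding computes_def
  proof (intro conjI allI impI)
    show "0 < max N M" using f(2) unfolding computes_def by auto
    fix s :: store assume s: "\<forall>i>0. i < max N M \<longrightarrow> s i = Lf"
    obtain t where t: "t \<le> T (s 0)" "run c s t (s(0 := f (s 0)))"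
      using computes_run[OF f' _ refl, of s] s by auto
    obtain u where u: "u \<le> R (f (s 0))" "run d (s(0 := f (s 0))) u (s(0 := g (f (s 0))))"
      using computes_run[OF g' _ refl, of "s(0 := f (s 0))"] s by auto
    show "\<exists>t\<le>T (s 0) + R (f (s 0)). run (Seq c d) s t (s(0 := g (f (s 0))))"
      by (rule exI[of _ "t + u"]) (use run.Seq[OF t(2) u(2)] t(1) u(1) in simp)
  qed
  moreover have "poly_bounded (\<lambda>x. T x + R (f x))"
    by (rule poly_bounded_add[OF f(1) poly_bounded_comp[OF g(1) ptime_sz[OF assms(2)]]])
  moreover have "poly_bounded (\<lambda>x. sz (g (f x)))"
    by (rule poly_bounded_comp[OF ptime_sz[OF assms(1)] ptime_sz[OF assms(2)]])
  ultimately show ?thesis by (rule ptimeI)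
qed

lemmas ptime_left = ptime_comp[OF ptime_left0]
lemmas ptime_right = ptime_comp[OF ptime_right0]

lemma run_Assign_Seq:
  assumes "r = s(x := eval_exp e s)" "run d r t s'"
  shows "run (Seq (Assign x e) d) s (Suc t) s'"
  using run.Seq[OF run.Assign[of x e s] assms(2)[unfolded assms(1)]] by simp

lemma run_Assign_eq: "s' = s(x := eval_exp e s) \<Longrightarrow> run (Assign x e) s (Suc 0) s'"
  using run.Assign by simp

lemma ptime_Br:
  assumes "ptime f" "ptime g"
  shows "ptime (\<lambda>x. Br (f x) (g x))"
proof -
  obtain c N T where f: "poly_bounded T" "computes c N T f"
    by (rule ptimeE[OF assms(1)])
  obtain d M R where g: "poly_bounded R" "computes d M R g"
    by (rule ptimeE[OF assms(2)])
  \<comment> \<open>Both variables lie above the scratch space of the two programs: \<open>y\<close>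
    keeps the input for the second call, \<open>z\<close> keeps the first result.\<close>
  define y z where "y = max N M" and "z = Suc y"
  have f': "computes c y T f" and g': "computes d y R g"
    unfolding y_def by (rule computes_weaken[OF f(2)] computes_weaken[OF g(2)]; simp)+
  have y0: "0 < y" using f(2) unfolding computes_def y_def by auto
  let ?p = "Seq (Assign y (Var 0)) (Seq c (Seq (Assign z (Var 0)) (Seq (Assign 0 (Var y)) (Seq d
     (Seq (Assign 0 (Pair z 0)) (Seq (Assign y Empty) (Assign z Empty)))))))"
  have "computes ?p (Suc z) (\<lambda>x. T x + R x + 6) (\<lambda>x. Br (f x) (g x))"
    unfolding computes_def
  proof (intro conjI allI impI)
    fix s :: store assume s: "\<forall>i>0. i < Suc z \<longrightarrow> s i = Lf"
    have yz: "s y = Lf" "s z = Lf" using s y0 unfolding z_def by auto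
    obtain t where t: "t \<le> T (s 0)" "run c (s(y := s 0)) t (s(y := s 0, 0 := f (s 0)))"
      using computes_run[OF f' _ refl, of "s(y := s 0)"] s y0 z_def by auto
    let ?s = "s(y := s 0, z := f (s 0), 0 := s 0)"
    obtain u where u: "u \<le> R (s 0)" "run d ?s u (?s(0 := g (s 0)))"
      using computes_run[OF g' _ refl, of ?s] s y0 z_def by auto
    let ?t = "Suc (t + (Suc (Suc (u + (Suc (Suc (Suc 0)))))))"
    let ?r = "s(0 := Br (f (s 0)) (g (s 0)))"
    have "run (Assign z Empty) (?r(z := f (s 0))) (Suc 0) ?r"
      by (rule run_Assign_eq) (use yz y0 z_def in \<open>simp add: fun_eq_iff\<close>)
    then have "run (Seq (Assign y Empty) (Assign z Empty)) (?r(y := s 0, z := f (s 0))) (Suc (Suc 0)) ?r"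
      by (rule run_Assign_Seq[rotated]) (use yz y0 z_def in \<open>simp add: fun_eq_iff\<close>)
    then have "run (Seq (Assign 0 (Pair z 0)) (Seq (Assign y Empty) (Assign z Empty))) (?s(0 := g (s 0)))
       (Suc (Suc (Suc 0))) ?r"
      by (rule run_Assign_Seq[rotated]) (use y0 z_def in \<open>simp add: fun_eq_iff\<close>)
    with u(2) have "run (Seq d (Seq (Assign 0 (Pair z 0)) (Seq (Assign y Empty) (Assign z Empty)))) ?s
       (u + Suc (Suc (Suc 0))) ?r"
      by (rule run.Seq)
    then have "run (Seq (Assign 0 (Var y)) (Seq d (Seq (Assign 0 (Pair z 0)) (Seq (Assign y Empty) (Assign z Empty)))))
       (s(y := s 0, z := f (s 0), 0 := f (s 0))) (Suc (u + Suc (Suc (Suc 0)))) ?r"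
      by (rule run_Assign_Seq[rotated]) (use y0 z_def in \<open>simp add: fun_eq_iff\<close>)
    then have "run (Seq (Assign z (Var 0)) (Seq (Assign 0 (Var y)) (Seq d (Seq (Assign 0 (Pair z 0)) (Seq (Assign y Empty) (Assign z Empty))))))
       (s(y := s 0, 0 := f (s 0))) (Suc (Suc (u + Suc (Suc (Suc 0))))) ?r"
      by (rule run_Assign_Seq[rotated]) (use y0 z_def in \<open>simp add: fun_eq_iff\<close>)
    with t(2) have "run (Seq c (Seq (Assign z (Var 0)) (Seq (Assign 0 (Var y)) (Seq d (Seq (Assign 0 (Pair z 0)) (Seq (Assign y Empty) (Assign z Empty)))))))
       (s(y := s 0)) (t + (Suc (Suc (u + Suc (Suc (Suc 0)))))) ?r"
      by (rule run.Seq)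
    then have "run ?p s ?t ?r"
      by (rule run_Assign_Seq[rotated]) simp
    moreover have "?t \<le> T (s 0) + R (s 0) + 6" using t u by simp
    ultimately show "\<exists>t\<le>T (s 0) + R (s 0) + 6. run ?p s t (s(0 := Br (f (s 0)) (g (s 0))))"
      by blast
  qed simp
  moreover have "poly_bounded (\<lambda>x. T x + R x + 6)"
    by (intro poly_bounded_intros f g)
  moreover have "poly_bounded (\<lambda>x. sz (Br (f x) (g x)))"
    using assms[THEN ptime_sz] by (simp only: sz.simps) (intro poly_bounded_intros)
  ultimately show ?thesis by (rule ptimeI)
qed

lemma ptime_if:
  assumes "ptime b" "ptime f" "ptime g"
  shows "ptime (\<lambda>x. if b x \<noteq> Lf then f x else g x)"
proof -
  \<comment> \<open>With \<open>Br (b x) x\<close> computed beforehand, the branching program below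
    only splits a pair: the test goes to \<open>y\<close>, the argument to variable 0.\<close>
  have br: "ptime (\<lambda>x. Br (b x) x)"
    by (intro ptime_Br assms ptime_id)
  obtain c N T where f: "poly_bounded T" "computes c N T f"
    by (rule ptimeE[OF assms(2)])
  obtain d M R where g: "poly_bounded R" "computes d M R g"
    by (rule ptimeE[OF assms(3)])
  define y where "y = max N M"
  have f': "computes c y T f" and g': "computes d y R g"
    unfolding y_def by (rule computes_weaken[OF f(2)] computes_weaken[OF g(2)]; simp)+
  have y0: "0 < y" using f(2) unfolding computes_def y_def by auto
  let ?h = "\<lambda>p. if left p \<noteq> Lf then f (right p) else g (right p)"
  let ?p = "Seq (Assign y (Left 0)) (Seq (Assign 0 (Right 0))
      (If y (Seq (Assign y Empty) c) d))"
  have "computes ?p (Suc y) (\<lambda>p. T (right p) + R (right p) + 4) ?h"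
    unfolding computes_def
  proof (intro conjI allI impI)
    fix s :: store assume s: "\<forall>i>0. i < Suc y \<longrightarrow> s i = Lf"
    let ?s1 = "s(y := left (s 0), 0 := right (s 0))"
    let ?s = "s(0 := right (s 0))"
    obtain t where t: "t \<le> T (right (s 0))" "run c ?s t (s(0 := f (right (s 0))))"
      using computes_run[OF f' _ refl, of ?s] s y0 by auto
    obtain u where u: "u \<le> R (right (s 0))" "run d ?s u (s(0 := g (right (s 0))))"
      using computes_run[OF g' _ refl, of ?s] s y0 by auto
    have eq: "?s1(y := Lf) = ?s" using s y0 by (auto simp: fun_eq_iff)
    have s1: "?s1 y = left (s 0)" using y0 by simp
    have sy: "s y = Lf" using s y0 by simp
    show "\<exists>t\<le>T (right (s 0)) + R (right (s 0)) + 4. run ?p s t (s(0 := ?h (s 0)))"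
    proof (cases "left (s 0) = Lf")
      case True
      have "?s1 = ?s" using True sy by (auto simp: fun_eq_iff)
      with u True s1 sy have "run (If y (Seq (Assign y Empty) c) d) ?s1 (u + 1) (s(0 := ?h (s 0)))"
        by (intro run.IfFalse) auto
      then have "run ?p s (Suc (Suc (u + 1))) (s(0 := ?h (s 0)))"
        using y0 by (intro run_Assign_Seq[where r = ?s1] run_Assign_Seq[where r = "s(y := left (s 0))"]) auto
      then show ?thesis using u by (intro exI[of _ "Suc (Suc (u + 1))"]) auto
    next
      case False
      have "run (Seq (Assign y Empty) c) ?s1 (Suc t) (s(0 := ?h (s 0)))"
        by (rule run_Assign_Seq[where r = ?s]) (use t False eq in simp_all)
      with False s1 have "run (If y (Seq (Assign y Empty) c) d) ?s1 (Suc t + 1) (s(0 := ?h (s 0)))"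
        by (intro run.IfTrue) auto
      then have "run ?p s (Suc (Suc (Suc t + 1))) (s(0 := ?h (s 0)))"
        using y0 by (intro run_Assign_Seq[where r = ?s1] run_Assign_Seq[where r = "s(y := left (s 0))"]) auto
      then show ?thesis using t by (intro exI[of _ "Suc (Suc (Suc t + 1))"]) auto
    qed
  qed simp
  moreover have "poly_bounded (\<lambda>x. T (right x) + R (right x) + 4)"
    by (intro poly_bounded_add poly_bounded_const poly_bounded_comp[OF f(1)]
        poly_bounded_comp[OF g(1)] ptime_sz ptime_right0)
  moreover have "poly_bounded (\<lambda>p. sz (?h p))"
    by (rule poly_bounded_mono[where g = "\<lambda>p. sz (f (right p)) + sz (g (right p))"])
      (intro poly_bounded_add ptime_sz ptime_comp[OF _ ptime_right0] assms, simp)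
  ultimately have "ptime ?h" by (rule ptimeI)
  from ptime_comp[OF this br] show ?thesis unfolding left.simps right.simps .
qed

lemma ptime_const: "ptime (\<lambda>x. c)"
  by (induction c) (simp_all add: ptime_Lf ptime_Br)

text \<open>A fold along the right spine, where \<open>enc_list\<close> stores its items. Unary
  numbers are lists of leaves, so this is also bounded iteration and the only loop that the
  reduction needs.\<close>

primrec bfold :: "(bintree \<Rightarrow> bintree) \<Rightarrow> bintree \<Rightarrow> bintree \<Rightarrow> bintree" where
  "bfold g Lf acc = acc"
| "bfold g (Br x xs) acc = bfold g xs (g (Br x acc))"

text \<open>The quantity \<open>Z + sz (low acc) + c * sz xs\<close> never increases, since a round
  adds at most \<open>c\<close> to the low part and shortens \<open>xs\<close>. So every round adds
  at most \<open>K * (m + 1) ^ d\<close>, and there are at most \<open>sz xs\<close> rounds.\<close>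

lemma bfold_size:
  assumes low: "\<And>y acc. sz (low (g (Br y acc))) \<le> sz (low acc) + c"
    and grow: "\<And>y acc. sz (g (Br y acc)) \<le> sz acc + K * sz (Br y (low acc)) ^ d"
  shows "sz xs \<le> Z \<Longrightarrow> Z + sz (low acc) + c * sz xs \<le> m \<Longrightarrow>
    sz (bfold g xs acc) \<le> sz acc + sz xs * (K * (m + 1) ^ d)"
proof (induction xs arbitrary: acc)
  case (Br y xs)
  have 1: "sz (g (Br y acc)) \<le> sz acc + K * (m + 1) ^ d"
  proof -
    have "sz (Br y (low acc)) \<le> m + 1" using Br.prems by simp
    then have "K * sz (Br y (low acc)) ^ d \<le> K * (m + 1) ^ d"
      by (intro mult_left_mono power_mono) auto
    with grow[of y acc] show ?thesis by linarith
  qed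
  have "c * sz (Br y xs) \<ge> c + c * sz xs" by (simp add: algebra_simps)
  with low[of y acc] Br.prems have m: "Z + sz (low (g (Br y acc))) + c * sz xs \<le> m" by linarith
  have 2: "sz (bfold g xs (g (Br y acc))) \<le> sz (g (Br y acc)) + sz xs * (K * (m + 1) ^ d)"
    by (rule Br.IH(2)[OF _ m]) (use Br.prems in simp)
  have "(sz xs + 1) * (K * (m + 1) ^ d) \<le> sz (Br y xs) * (K * (m + 1) ^ d)"
    by (intro mult_right_mono) auto
  moreover have "(sz xs + 1) * (K * (m + 1) ^ d) = sz xs * (K * (m + 1) ^ d) + K * (m + 1) ^ d"
    by (simp add: algebra_simps)
  ultimately show ?case using 1 2 unfolding bfold.simps by linarith
qed simp

text \<open>\<open>Q\<close> bounds the accumulator in all rounds and hence the cost of each call;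
  the 4 extra steps of a round are three assignments and the loop test. The last item remains in
  \<open>z\<close>, so the final store is described only up to \<open>z\<close>, which is cleared
  once after the loop.\<close>

lemma while_bfold:
  assumes g: "computes c y T g" and y: "0 < y" and z: "z = Suc y"
    and low: "\<And>y acc. sz (low (g (Br y acc))) \<le> sz (low acc) + e"
    and grow: "\<And>y acc. sz (g (Br y acc)) \<le> sz acc + K * sz (Br y (low acc)) ^ d"
    and T: "\<And>x. T x \<le> K' * sz x ^ d'"
    and body: "body = Seq (Assign z (Left y)) (Seq (Assign 0 (Pair z 0)) (Seq c (Assign y (Right y))))"
  shows "\<lbrakk>\<And>i. 0 < i \<Longrightarrow> i < y \<Longrightarrow> s i = Lf; s y = xs; sz xs + sz (s 0) + sz xs * (K * (m + 1) ^ d) \<le> Q;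
      sz xs \<le> Z; Z + sz (low (s 0)) + e * sz xs \<le> m\<rbrakk> \<Longrightarrow>
    \<exists>t s'. t \<le> sz xs * (K' * (Q + 1) ^ d' + 4) + 1 \<and> run (While y body) s t s' \<and>
      s'(z := Lf) = s(0 := bfold g xs (s 0), y := Lf, z := Lf)"
proof (induction xs arbitrary: s)
  case Lf
  then have "run (While y body) s 1 s" by (intro run.WhileFalse) auto
  then show ?case using Lf
    by (intro exI[of _ 1] exI[of _ s]) (auto simp: fun_eq_iff)
next
  case (Br x xs)
  let ?acc = "g (Br x (s 0))"
  let ?s1 = "s(z := x, 0 := Br x (s 0))"
  let ?s2 = "s(z := x, 0 := ?acc)"
  let ?s3 = "s(z := x, 0 := ?acc, y := xs)"
  obtain t where t: "t \<le> T (Br x (s 0))" "run c ?s1 t ?s2"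
    using computes_run[OF g _ refl, of ?s1] Br.prems y z by auto
  have mult: "(sz xs + 1) * (K * (m + 1) ^ d) \<le> sz (Br x xs) * (K * (m + 1) ^ d)"
    by (intro mult_right_mono) auto
  have "T (Br x (s 0)) \<le> K' * (Q + 1) ^ d'"
  proof -
    have "sz (Br x (s 0)) \<le> Q + 1" using Br.prems(3) by simp
    then have "K' * sz (Br x (s 0)) ^ d' \<le> K' * (Q + 1) ^ d'"
      by (intro mult_left_mono power_mono) auto
    with T show ?thesis using order_trans by blast
  qed
  with t have tt: "t \<le> K' * (Q + 1) ^ d'" by linarith
  have acc: "sz ?acc \<le> sz (s 0) + K * (m + 1) ^ d"
  proof -
    have "sz (Br x (low (s 0))) \<le> m + 1" using Br.prems by simp
    then have "K * sz (Br x (low (s 0))) ^ d \<le> K * (m + 1) ^ d"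
      by (intro mult_left_mono power_mono) auto
    with grow[of x "s 0"] show ?thesis by linarith
  qed
  have body': "run body s (Suc (Suc (t + Suc 0))) ?s3"
    unfolding body
  proof (rule run_Assign_Seq[where r = "s(z := x)"], goal_cases)
    case 2
    show ?case
    proof (rule run_Assign_Seq[where r = ?s1], goal_cases)
      case 2
      have "run (Assign y (Right y)) ?s2 (Suc 0) ?s3"
        by (rule run_Assign_eq) (use Br.prems(2) y z in simp)
      with t(2) show ?case by (rule run.Seq)
    qed (use y z in \<open>simp add: fun_eq_iff\<close>)
  qed (use Br.prems(2) in simp)
  have "\<exists>t s'. t \<le> sz xs * (K' * (Q + 1) ^ d' + 4) + 1 \<and> run (While y body) ?s3 t s' \<and>
      s'(z := Lf) = ?s3(0 := bfold g xs (?s3 0), y := Lf, z := Lf)"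
  proof (rule Br.IH(2))
    show "\<And>i. 0 < i \<Longrightarrow> i < y \<Longrightarrow> ?s3 i = Lf" using Br.prems z by auto
    show "?s3 y = xs" by simp
    have "(sz xs + 1) * (K * (m + 1) ^ d) = sz xs * (K * (m + 1) ^ d) + K * (m + 1) ^ d"
      by (simp add: algebra_simps)
    then have "sz xs + sz ?acc + sz xs * (K * (m + 1) ^ d) \<le> Q"
      using mult acc Br.prems(3) unfolding sz.simps(2)[of x xs] by linarith
    then show "sz xs + sz (?s3 0) + sz xs * (K * (m + 1) ^ d) \<le> Q" using y by simp
    show "sz xs \<le> Z" using Br.prems by simp
    have "e * sz (Br x xs) \<ge> e + e * sz xs" by (simp add: algebra_simps)
    with low[of x "s 0"] Br.prems(5) have "Z + sz (low ?acc) + e * sz xs \<le> m" by linarith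
    then show "Z + sz (low (?s3 0)) + e * sz xs \<le> m" using y by simp
  qed
  then obtain t' s' where t': "t' \<le> sz xs * (K' * (Q + 1) ^ d' + 4) + 1"
    "run (While y body) ?s3 t' s'" "s'(z := Lf) = ?s3(0 := bfold g xs (?s3 0), y := Lf, z := Lf)"
    by blast
  have r: "run (While y body) s (Suc (Suc (t + Suc 0)) + t' + 1) s'"
    by (rule run.WhileTrue[OF _ body' t'(2)]) (use Br.prems in simp)
  have "(sz xs + 1) * (K' * (Q + 1) ^ d' + 4) \<le> sz (Br x xs) * (K' * (Q + 1) ^ d' + 4)"
    by (intro mult_right_mono) auto
  moreover have "(sz xs + 1) * (K' * (Q + 1) ^ d' + 4) = sz xs * (K' * (Q + 1) ^ d' + 4) + K' * (Q + 1) ^ d' + 4"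
    by (simp add: algebra_simps)
  ultimately have b: "Suc (Suc (t + Suc 0)) + t' + 1 \<le> sz (Br x xs) * (K' * (Q + 1) ^ d' + 4) + 1"
    using t'(1) tt by linarith
  have e: "s'(z := Lf) = s(0 := bfold g (Br x xs) (s 0), y := Lf, z := Lf)"
    unfolding t'(3) using y z by (auto simp: fun_eq_iff)
  show ?case by (intro exI conjI) (rule b, rule r, rule e)
qed

text \<open>Iterating a polynomial-time step can square sizes repeatedly. It is harmless if every round
  adds a bounded amount to some part \<open>low\<close> of the state and the growth of the whole state is
  polynomial in that part and the current list item.\<close>

lemma ptime_bfold:
  assumes g: "ptime g" and f: "ptime f" and h: "ptime h" and low0: "\<And>x. sz (low x) \<le> sz x"
    and low: "\<And>y acc. sz (low (g (Br y acc))) \<le> sz (low acc) + e"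
    and P: "poly_bounded P"
    and grow: "\<And>y acc. sz (g (Br y acc)) \<le> sz acc + P (Br y (low acc))"
  shows "ptime (\<lambda>x. bfold g (f x) (h x))"
proof -
  obtain K d where "\<And>x. P x \<le> K * sz x ^ d" using P unfolding poly_bounded_def by blast
  then have grow: "\<And>y acc. sz (g (Br y acc)) \<le> sz acc + K * sz (Br y (low acc)) ^ d"
    using grow by (meson add_left_mono order_trans)
  obtain c N T where c: "poly_bounded T" "computes c N T g"
    by (rule ptimeE[OF g])
  then obtain K' d' where T: "\<And>x. T x \<le> K' * sz x ^ d'" unfolding poly_bounded_def by blast
  define z where "z = Suc N"
  define body where "body = Seq (Assign z (Left N)) (Seq (Assign 0 (Pair z 0)) (Seq c (Assign N (Right N))))"
  have N: "0 < N" using c(2) unfolding computes_def by simp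
  let ?m = "\<lambda>p. 2 * sz p + e * sz p"
  let ?Q = "\<lambda>p. 2 * sz p + sz p * (K * (?m p + 1) ^ d)"
  let ?R = "\<lambda>p. sz p * (K' * (?Q p + 1) ^ d' + 4) + 4"
  let ?b = "\<lambda>p. bfold g (left p) (right p)"
  have le: "sz (left p) \<le> sz p" "sz (right p) \<le> sz p" for p by (cases p; simp)+
  have m: "sz p + sz (low (right p)) + e * sz (left p) \<le> ?m p" for p
    using le[of p] low0[of "right p"] mult_left_mono[OF le(1)[of p], of e] by linarith
  have Q: "sz (left p) + sz (right p) + sz (left p) * (K * (?m p + 1) ^ d) \<le> ?Q p" for p
  proof -
    have "sz (left p) * (K * (?m p + 1) ^ d) \<le> sz p * (K * (?m p + 1) ^ d)"
      by (intro mult_right_mono le) simp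
    with le[of p] show ?thesis by linarith
  qed
  have "computes (Seq (Assign N (Left 0)) (Seq (Assign 0 (Right 0)) (Seq (While N body) (Assign z Empty))))
     (Suc z) ?R ?b" (is "computes ?p _ _ _")
    unfolding computes_def
  proof (intro conjI allI impI)
    fix s :: store assume s: "\<forall>i>0. i < Suc z \<longrightarrow> s i = Lf"
    let ?s = "s(N := left (s 0), 0 := right (s 0))"
    have s0: "s N = Lf" "s z = Lf" using s N z_def by auto
    have "\<exists>t s'. t \<le> sz (left (s 0)) * (K' * (?Q (s 0) + 1) ^ d' + 4) + 1 \<and> run (While N body) ?s t s' \<and>
      s'(z := Lf) = ?s(0 := bfold g (left (s 0)) (?s 0), N := Lf, z := Lf)"
      by (rule while_bfold[where low = low and e = e and K = K and d = d and c = c and T = T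
           and m = "?m (s 0)" and Z = "sz (s 0)", OF c(2) N z_def low grow T body_def])
         (use s N m[of "s 0"] Q[of "s 0"] le[of "s 0"] z_def in auto)
    then obtain t s' where t: "t \<le> sz (left (s 0)) * (K' * (?Q (s 0) + 1) ^ d' + 4) + 1"
      "run (While N body) ?s t s'" "s'(z := Lf) = ?s(0 := bfold g (left (s 0)) (?s 0), N := Lf, z := Lf)"
      by blast
    have fin: "s'(z := Lf) = s(0 := ?b (s 0))"
      unfolding t(3) using s0 N z_def by (auto simp: fun_eq_iff)
    have "run ?p s (Suc (Suc (t + Suc 0))) (s(0 := ?b (s 0)))"
    proof (rule run_Assign_Seq[where r = "s(N := left (s 0))"], goal_cases)
      case 2
      show ?case
      proof (rule run_Assign_Seq[where r = ?s], goal_cases)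
        case 2
        have "run (Assign z Empty) s' (Suc 0) (s(0 := ?b (s 0)))"
          by (rule run_Assign_eq) (simp only: eval_exp.simps fin)
        with t(2) show ?case by (rule run.Seq)
      qed (use N in simp)
    qed simp
    moreover have "Suc (Suc (t + Suc 0)) \<le> ?R (s 0)"
    proof -
      have "sz (left (s 0)) * (K' * (?Q (s 0) + 1) ^ d' + 4) \<le> sz (s 0) * (K' * (?Q (s 0) + 1) ^ d' + 4)"
        by (intro mult_right_mono le) simp
      with t(1) show ?thesis by linarith
    qed
    ultimately show "\<exists>t\<le>?R (s 0). run ?p s t (s(0 := ?b (s 0)))" by blast
  qed simp
  moreover have "poly_bounded ?R" by (intro poly_bounded_intros)
  moreover have "poly_bounded (\<lambda>p. sz (?b p))"
  proof (rule poly_bounded_mono[of ?Q])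
    show "poly_bounded ?Q" by (intro poly_bounded_intros)
    show "sz (?b p) \<le> ?Q p" for p
      using bfold_size[OF low grow le(1)[of p] m[of p]] Q[of p] by simp
  qed
  ultimately have "ptime ?b" by (rule ptimeI)
  from ptime_comp[OF this ptime_Br[OF f h]] show ?thesis by simp
qed


section \<open>The graph of a system of gadgets\<close>

text \<open>One step of the walk along the antidiagonals, the order in which
  \<open>prod_encode\<close> numbers the pairs. Such a local move can be iterated by a tree program,
  which thus has no square root to compute.\<close>

fun next_pair :: "nat \<times> nat \<Rightarrow> nat \<times> nat" where
  "next_pair (i, Suc j) = (Suc i, j)"
| "next_pair (i, 0) = (0, Suc i)"

definition pair_of :: "nat \<Rightarrow> nat \<times> nat" where
  "pair_of r = (next_pair ^^ r) (0, 0)"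

lemma prod_encode_pair_of: "prod_encode (pair_of r) = r"
proof (induction r)
  case (Suc r)
  have "prod_encode (next_pair p) = Suc (prod_encode p)" for p
    by (cases p rule: next_pair.cases) (simp_all add: prod_encode_def)
  with Suc show ?case by (simp add: pair_of_def)
qed (simp add: pair_of_def prod_encode_def)

lemma pair_of_inject: "pair_of r = pair_of r' \<longleftrightarrow> r = r'"
  by (metis prod_encode_pair_of)

definition diag :: "nat \<Rightarrow> nat" where
  "diag r = fst (pair_of r) + snd (pair_of r)"

lemma mono_diag: "r \<le> r' \<Longrightarrow> diag r \<le> diag r'"
proof (induction r' rule: dec_induct)
  case (step m)
  have "fst p + snd p \<le> fst (next_pair p) + snd (next_pair p)" for p
    by (cases p rule: next_pair.cases) simp_all
  from this[of "pair_of m"] step show ?case by (simp add: diag_def pair_of_def)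
qed simp

text \<open>\<open>triangle (diag r)\<close> is the number of the first pair on the antidiagonal of
  pair \<open>r\<close>. This is the source of the square root in the pathwidth.\<close>

lemma triangle_diag_le: "triangle (diag r) \<le> r"
  using prod_encode_pair_of[of r] by (simp add: diag_def prod_encode_def case_prod_beta)

definition pos :: "literal \<Rightarrow> nat \<times> nat" where
  "pos = (\<lambda>(v, s). pair_of (2 * v + of_bool s))"

lemma pos_inject: "pos x = pos y \<longleftrightarrow> x = y"
proof
  assume "pos x = pos y"
  then have "2 * fst x + of_bool (snd x) = (2 * fst y + of_bool (snd y) :: nat)"
    by (simp add: pos_def pair_of_inject case_prod_beta)
  then show "x = y"
    by (cases x; cases y; cases "snd x"; cases "snd y") (auto, presburger+)
qed simp

datatype vert = U nat | W nat | X nat nat nat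

text \<open>Template vertices of a gadget: the ports of its \<open>t\<close>-th node and its private vertices.\<close>

datatype slot = SU nat | SW nat | SX nat nat

fun inst :: "nat \<Rightarrow> literal list \<Rightarrow> slot \<Rightarrow> vert" where
  "inst g xs (SU t) = U (fst (pos (xs ! t)))"
| "inst g xs (SW t) = W (snd (pos (xs ! t)))"
| "inst g xs (SX c h) = X g c h"

text \<open>A path with \<open>L\<close> edges has the inner vertices \<open>SX t 0\<close> to
  \<open>SX t (L - 2)\<close>; the first is called its head. Arcs run from the core to private
  vertices and then upwards in a row, so that the vertex numbers will increase along them.\<close>

definition path_edges :: "nat \<Rightarrow> nat \<Rightarrow> (slot \<times> slot) list" where
  "path_edges L t = (SU t, SX t 0) # (SW t, SX t (L - 2)) #
     map (\<lambda>h. (SX t h, SX t (Suc h))) [0..<L - 2]"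

text \<open>Rows 0 to 2 hold the inner vertices of the paths; rows 3 to 5 are reserved for closing a
  cycle through the heads of \<open>t\<close> and \<open>t'\<close>.\<close>

definition conflicts :: "nat \<Rightarrow> (nat \<times> nat \<times> nat) list" where
  "conflicts q = filter (\<lambda>(c, t, t'). t' < q) [(3, 0, 1), (4, 0, 2), (5, 1, 2)]"

text \<open>The closing row \<open>c\<close> has \<open>l - 2\<close> vertices, which together with
  the two adjacent heads make a cycle of length \<open>l\<close>.\<close>

definition conflict_edges :: "nat \<Rightarrow> nat \<times> nat \<times> nat \<Rightarrow> (slot \<times> slot) list" where
  "conflict_edges l = (\<lambda>(c, t, t'). (SX t 0, SX t' 0) # (SX t 0, SX c 0) # (SX t' 0, SX c (l - 3)) #
     map (\<lambda>h. (SX c h, SX c (Suc h))) [0..<l - 3])"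

definition short_len :: "nat \<Rightarrow> nat" where "short_len l = (l - 1) div 2"

text \<open>Gadgets with two nodes belong to variables, gadgets with three nodes to clauses; the lengths of
  their paths add up to \<open>l\<close>.\<close>

definition path_len :: "nat \<Rightarrow> nat \<Rightarrow> nat" where
  "path_len l q = (if q = 2 then short_len l else l - short_len l)"

definition template :: "nat \<Rightarrow> nat \<Rightarrow> (slot \<times> slot) list" where
  "template l q = concat (map (path_edges (path_len l q)) [0..<q]) @
     concat (map (conflict_edges l) (conflicts q))"

text \<open>Here \<open>l >= 5\<close> enters: for \<open>l = 4\<close> the short path would be a
  single edge, without an inner vertex to delete. The last bound makes every path fit into a row of
  \<open>l\<close> private vertices.\<close>

lemma short_len:
  assumes "l \<ge> 5"
  shows "2 \<le> short_len l" "short_len l < l - short_len l" "l < 4 * short_len l"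
    "l < 2 * (l - short_len l)" "2 \<le> path_len l q" "path_len l q + 2 \<le> l"
  using assms unfolding short_len_def path_len_def by (auto; presburger)+

lemma mem_conflicts: "(c, t, t') \<in> set (conflicts q) \<longleftrightarrow>
    t' < q \<and> (c = 3 \<and> t = 0 \<and> t' = 1 \<or> c = 4 \<and> t = 0 \<and> t' = 2 \<or> c = 5 \<and> t = 1 \<and> t' = 2)"
  unfolding conflicts_def set_filter by auto

lemma conflictsD:
  assumes "(c, t, t') \<in> set (conflicts q)"
  shows "3 \<le> c" "c < 6" "t < t'" "t' < q" "t' < 3"
  using assms by (auto simp: mem_conflicts)

lemma conflicts_unique:
  assumes "(c, t, t') \<in> set (conflicts q)" "(c, r, r') \<in> set (conflicts q)"
  shows "r = t" "r' = t'"
  using assms by (auto simp: mem_conflicts)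

lemma mem_path_edges:
  "(x, y) \<in> set (path_edges L t) \<longleftrightarrow> x = SU t \<and> y = SX t 0 \<or> x = SW t \<and> y = SX t (L - 2) \<or>
        (\<exists>h<L - 2. x = SX t h \<and> y = SX t (Suc h))"
  by (auto simp: path_edges_def)

lemma mem_conflict_edges:
  "(x, y) \<in> set (conflict_edges l (c, t, t')) \<longleftrightarrow>
     x = SX t 0 \<and> (y = SX t' 0 \<or> y = SX c 0) \<or> x = SX t' 0 \<and> y = SX c (l - 3) \<or>
         (\<exists>h<l - 3. x = SX c h \<and> y = SX c (Suc h))"
  by (auto simp: conflict_edges_def)

lemma mem_template:
  "(x, y) \<in> set (template l q) \<longleftrightarrow>
     (\<exists>t<q. x = SU t \<and> y = SX t 0 \<or> x = SW t \<and> y = SX t (path_len l q - 2) \<or>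
        (\<exists>h<path_len l q - 2. x = SX t h \<and> y = SX t (Suc h))) \<or>
     (\<exists>c t t'. (c, t, t') \<in> set (conflicts q) \<and>
        (x = SX t 0 \<and> (y = SX t' 0 \<or> y = SX c 0) \<or> x = SX t' 0 \<and> y = SX c (l - 3) \<or>
         (\<exists>h<l - 3. x = SX c h \<and> y = SX c (Suc h))))"
  by (simp add: template_def mem_path_edges mem_conflict_edges Bex_def)

text \<open>Predecessor and successor differ because the length is at least 3, so one of them is not
  \<open>z\<close>. The free \<open>z\<close> puts "degree at least two" into the form in which it
  is applied: excluding one known neighbour yields the other.\<close>

lemma is_cycle_neighbour:
  assumes "is_cycle E vs" "x \<in> set vs"
  shows "\<exists>y\<in>set vs. {x, y} \<in> E \<and> y \<noteq> z"
proof -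
  obtain i where i: "i < length vs" "x = vs ! i" using assms(2) by (metis in_set_conv_nth)
  let ?n = "length vs"
  have cyc: "3 \<le> ?n" "distinct vs" "\<And>i. i < ?n \<Longrightarrow> {vs ! i, vs ! (Suc i mod ?n)} \<in> E"
    using assms(1) unfolding is_cycle_def by auto
  define j k where "j = Suc i mod ?n" and "k = (if i = 0 then ?n - 1 else i - 1)"
  have jk: "j < ?n" "k < ?n" "Suc k mod ?n = i" "j \<noteq> k"
    using i cyc(1) by (auto simp: j_def k_def mod_Suc)
  then have "vs ! j \<noteq> vs ! k" using cyc(2) by (simp add: nth_eq_iff_index_eq)
  moreover have "{x, vs ! j} \<in> E" using cyc(3)[OF i(1)] i(2) j_def by simp
  moreover have "{x, vs ! k} \<in> E" using cyc(3)[OF jk(2)] i(2) jk(3) by (simp add: insert_commute)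
  ultimately show ?thesis using jk(1,2) by (metis nth_mem)
qed

lemma is_cycleI:
  assumes "3 \<le> length vs" "distinct vs" "successively (\<lambda>x y. {x, y} \<in> E) vs" "{last vs, hd vs} \<in> E"
  shows "is_cycle E vs"
  unfolding is_cycle_def
proof (intro conjI allI impI)
  fix i assume i: "i < length vs"
  show "{vs ! i, vs ! (Suc i mod length vs)} \<in> E"
  proof (cases "Suc i < length vs")
    case True
    then show ?thesis using assms(3) by (simp add: successively_conv_nth)
  next
    case False
    with i have "length vs = Suc i" by simp
    moreover from this have "vs \<noteq> []" by auto
    ultimately show ?thesis using assms(4) by (simp add: last_conv_nth hd_conv_nth)
  qed
qed (use assms in auto)

lemma successively_upt: "successively P [m..<n] \<longleftrightarrow> (\<forall>h. m \<le> h \<and> Suc h < n \<longrightarrow> P h (Suc h))"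
proof -
  have "(\<forall>i. Suc i < n - m \<longrightarrow> P (m + i) (Suc (m + i))) \<longleftrightarrow> (\<forall>h. m \<le> h \<and> Suc h < n \<longrightarrow> P h (Suc h))"
  proof safe
    fix h assume *: "\<forall>i. Suc i < n - m \<longrightarrow> P (m + i) (Suc (m + i))" "m \<le> h" "Suc h < n"
    from *(1)[rule_format, of "h - m"] *(2,3) show "P h (Suc h)" by simp
  qed auto
  then show ?thesis by (simp add: successively_conv_nth)
qed

locale gadget_graph =
  fixes l :: nat and gs :: "literal list list"
  assumes l5: "l \<ge> 5" and gs_length: "\<And>g. g < length gs \<Longrightarrow> length (gs ! g) = 2 \<or> length (gs ! g) = 3"
begin

abbreviation "G \<equiv> length gs"
abbreviation "q g \<equiv> length (gs ! g)"
abbreviation "L g \<equiv> path_len l (q g)"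

definition upos :: "nat \<Rightarrow> nat \<Rightarrow> nat" where "upos g t = fst (pos (gs ! g ! t))"
definition wpos :: "nat \<Rightarrow> nat \<Rightarrow> nat" where "wpos g t = snd (pos (gs ! g ! t))"

definition gadget_edges :: "nat \<Rightarrow> (vert \<times> vert) list" where
  "gadget_edges g = map (map_prod (inst g (gs ! g)) (inst g (gs ! g))) (template l (q g))"

definition arc :: "nat \<Rightarrow> vert \<Rightarrow> vert \<Rightarrow> bool" where
  "arc g x y \<longleftrightarrow> (x, y) \<in> set (gadget_edges g)"

definition EE :: "vert set set" where
  "EE = (\<Union>g<G. (\<lambda>(x, y). {x, y}) ` set (gadget_edges g))"

lemma arc_iff:
  "arc g x y \<longleftrightarrow>
     (\<exists>t<q g. x = U (upos g t) \<and> y = X g t 0 \<or> x = W (wpos g t) \<and> y = X g t (L g - 2) \<or>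
        (\<exists>h<L g - 2. x = X g t h \<and> y = X g t (Suc h))) \<or>
     (\<exists>c t t'. (c, t, t') \<in> set (conflicts (q g)) \<and>
        (x = X g t 0 \<and> (y = X g t' 0 \<or> y = X g c 0) \<or> x = X g t' 0 \<and> y = X g c (l - 3) \<or>
         (\<exists>h<l - 3. x = X g c h \<and> y = X g c (Suc h))))"
  (is "_ \<longleftrightarrow> ?R")
proof
  assume "arc g x y"
  then obtain u v where uv: "(u, v) \<in> set (template l (q g))" "x = inst g (gs ! g) u" "y = inst g (gs ! g) v"
    by (auto simp: arc_def gadget_edges_def)
  from uv(1) show ?R unfolding mem_template uv(2,3) upos_def wpos_def
    by (elim disjE exE conjE) (simp_all, blast+)
next
  have A: "(u, v) \<in> set (template l (q g)) \<Longrightarrow> x = inst g (gs ! g) u \<Longrightarrow> y = inst g (gs ! g) v \<Longrightarrow> arc g x y" for u v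
    unfolding arc_def gadget_edges_def by force
  assume ?R
  then show "arc g x y"
  proof (elim disjE exE conjE)
    fix t assume "t < q g" "x = U (upos g t)" "y = X g t 0"
    then show ?thesis by (intro A[of "SU t" "SX t 0"]) (simp_all add: mem_template upos_def)
  next
    fix t assume "t < q g" "x = W (wpos g t)" "y = X g t (L g - 2)"
    then show ?thesis by (intro A[of "SW t" "SX t (L g - 2)"]) (simp_all add: mem_template wpos_def)
  next
    fix t h assume "t < q g" "h < L g - 2" "x = X g t h" "y = X g t (Suc h)"
    then show ?thesis by (intro A[of "SX t h" "SX t (Suc h)"]) (auto simp add: mem_template)
  next
    fix c t t' assume "(c, t, t') \<in> set (conflicts (q g))" "x = X g t 0" "y = X g t' 0"
    then show ?thesis by (intro A[of "SX t 0" "SX t' 0"]) (auto simp add: mem_template)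
  next
    fix c t t' assume "(c, t, t') \<in> set (conflicts (q g))" "x = X g t 0" "y = X g c 0"
    then show ?thesis by (intro A[of "SX t 0" "SX c 0"]) (auto simp add: mem_template)
  next
    fix c t t' assume "(c, t, t') \<in> set (conflicts (q g))" "x = X g t' 0" "y = X g c (l - 3)"
    then show ?thesis by (intro A[of "SX t' 0" "SX c (l - 3)"]) (auto simp add: mem_template)
  next
    fix c t t' h assume "(c, t, t') \<in> set (conflicts (q g))" "h < l - 3" "x = X g c h" "y = X g c (Suc h)"
    then show ?thesis by (intro A[of "SX c h" "SX c (Suc h)"]) (auto simp add: mem_template)
  qed
qed

lemma EE_iff: "{x, y} \<in> EE \<longleftrightarrow> (\<exists>g<G. arc g x y \<or> arc g y x)"
  by (auto simp: EE_def arc_def doubleton_eq_iff)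

section \<open>Neighbourhoods in the gadget graph\<close>

lemma nbr_U: "{U i, y} \<in> EE \<Longrightarrow> \<exists>g<G. \<exists>t<q g. y = X g t 0 \<and> upos g t = i"
  unfolding EE_iff arc_iff by auto

lemma nbr_W: "{W j, y} \<in> EE \<Longrightarrow> \<exists>g<G. \<exists>t<q g. y = X g t (L g - 2) \<and> wpos g t = j"
  unfolding EE_iff arc_iff by auto

lemma nbr_X:
  assumes "{X g c h, y} \<in> EE"
  shows "g < G \<and> (c < q g \<and> h \<le> L g - 2 \<or> h \<le> l - 3 \<and> (\<exists>t t'. (c, t, t') \<in> set (conflicts (q g))))"
proof -
  have D: "r < q g \<and> r' < q g" if "(c, r, r') \<in> set (conflicts (q g))" for c r r'
    using conflictsD[OF that] by auto
  show ?thesis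
    using assms l5 unfolding EE_iff arc_iff by (auto dest: D)
qed

text \<open>A gadget has at most three nodes, so path rows and closing rows never coincide. A vertex
  of a closing row meets only its neighbours in the row, with a head in place of the missing one at
  either end.\<close>

lemma nbr_conflict:
  assumes "{X g c h, y} \<in> EE" "(c, t, t') \<in> set (conflicts (q g))"
  shows "h \<le> l - 3 \<and> (y = (if h = 0 then X g t 0 else X g c (h - 1)) \<or>
    y = (if h = l - 3 then X g t' 0 else X g c (Suc h)))"
proof -
  have g: "g < G" using nbr_X[OF assms(1)] by simp
  have c: "3 \<le> c" "\<not> c < q g" using conflictsD[OF assms(2)] gs_length[OF g] by auto
  have C: "r = t" "r' = t'" if "(c, r, r') \<in> set (conflicts (q g))" for r r'
    using conflicts_unique[OF assms(2) that] .
  have C': "(d, c, r') \<notin> set (conflicts (q g))" "(d, r', c) \<notin> set (conflicts (q g))" for d r'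
    using conflictsD[of d c r' "q g"] conflictsD[of d r' c "q g"] c by auto
  show ?thesis
    using assms(1) c l5 unfolding EE_iff arc_iff
    by (auto simp: C' dest: C)
qed

lemma nbr_path:
  assumes "{X g t h, y} \<in> EE" "t < q g" "0 < h"
  shows "h \<le> L g - 2 \<and> (y = X g t (h - 1) \<or>
    y = (if h = L g - 2 then W (wpos g t) else X g t (Suc h)))"
proof -
  have g: "g < G" using nbr_X[OF assms(1)] by simp
  have C: "(t, r, r') \<notin> set (conflicts (q g))" for r r'
    using conflictsD(1)[of t r r' "q g"] gs_length[OF g] assms(2) by auto
  show ?thesis
    using assms unfolding EE_iff arc_iff by (auto simp: C)
qed

text \<open>Heads are the only private vertices of degree above two: besides their path they meet
  closing rows and the other heads of the gadget.\<close>

lemma nbr_head: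
  assumes "{X g t 0, y} \<in> EE" "t < q g"
  shows "y = U (upos g t) \<or> y = (if L g = 2 then W (wpos g t) else X g t 1) \<or>
    (\<exists>t'<q g. t' \<noteq> t \<and> y = X g t' 0) \<or> (\<exists>c h t t'. (c, t, t') \<in> set (conflicts (q g)) \<and> y = X g c h)"
proof -
  have g: "g < G" using nbr_X[OF assms(1)] by simp
  have C: "(t, r, r') \<notin> set (conflicts (q g))" for r r'
    using conflictsD(1)[of t r r' "q g"] gs_length[OF g] assms(2) by auto
  have L: "L g \<ge> 2" using short_len(5)[OF l5] .
  have D: "r < q g \<and> r' < q g \<and> r \<noteq> r'" if "(c, r, r') \<in> set (conflicts (q g))" for c r r'
    using conflictsD[OF that] by auto
  show ?thesis
    using assms L unfolding EE_iff arc_iff by (auto simp: C dest: D)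
qed

text \<open>No cycle is analysed below: the vertex set of a cycle has minimum degree two, and that is all
  that the lower bound on its length uses.\<close>

lemma min_degree_two_large:
  assumes surv: "\<And>g. g < G \<Longrightarrow> surv g < q g"
    and parallel: "\<And>g g'. g < G \<Longrightarrow> g' < G \<Longrightarrow> g \<noteq> g' \<Longrightarrow>
      pos (gs ! g ! surv g) = pos (gs ! g' ! surv g') \<Longrightarrow> q g = 3 \<and> q g' = 3"
    and fin: "finite C" and ne: "C \<noteq> {}"
    and avoid: "\<And>g t. g < G \<Longrightarrow> t < q g \<Longrightarrow> t \<noteq> surv g \<Longrightarrow> X g t 0 \<notin> C"
    and deg: "\<And>x z. x \<in> C \<Longrightarrow> \<exists>y\<in>C. {x, y} \<in> EE \<and> y \<noteq> z"
  shows "l < card C"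
proof -
  note sl = short_len[OF l5]
  \<comment> \<open>At most one of the two heads tied by a closing row is a survivor, so the other
    is missing from \<open>C\<close>. From that end the row is peeled off by induction: each vertex
    in turn has at most one neighbour left in \<open>C\<close>, against \<open>deg\<close>.\<close>
  have conflict: "X g c h \<notin> C" if c: "(c, t, t') \<in> set (conflicts (q g))" and g: "g < G" for g c t t' h
  proof (cases "t = surv g")
    case False
    have "X g t 0 \<notin> C" using avoid[OF g _ False] conflictsD[OF c] by simp
    then show ?thesis
    proof (induction h)
      case 0
      show ?case using deg[of "X g c 0" "if 0 = l - 3 then X g t' 0 else X g c (Suc 0)"] nbr_conflict[OF _ c] 0
        by fastforce
    next
      case (Suc h)
      show ?case using deg[of "X g c (Suc h)" "if Suc h = l - 3 then X g t' 0 else X g c (Suc (Suc h))"]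
          nbr_conflict[OF _ c, of "Suc h"] Suc by fastforce
    qed
  next
    case True
    have t': "X g t' 0 \<notin> C" using avoid[OF g, of t'] conflictsD[OF c] True by simp
    have "X g c (l - 3 - k) \<notin> C" for k
    proof (induction k)
      case 0
      show ?case using deg[of "X g c (l - 3)" "if l - 3 = 0 then X g t 0 else X g c (l - 3 - 1)"]
          nbr_conflict[OF _ c, of "l - 3"] t' by fastforce
    next
      case (Suc k)
      show ?case
      proof (cases "k < l - 3")
        case True
        then have "Suc (l - 3 - Suc k) = l - 3 - k" "l - 3 - Suc k \<noteq> l - 3" by auto
        then show ?thesis
          using deg[of "X g c (l - 3 - Suc k)" "if l - 3 - Suc k = 0 then X g t 0 else X g c (l - 3 - Suc k - 1)"]
            nbr_conflict[OF _ c, of "l - 3 - Suc k"] Suc by fastforce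
      qed (use Suc in simp)
    qed
    from this[of "l - 3 - h"] have "X g c h \<notin> C" if "h \<le> l - 3" using that by (metis diff_diff_cancel)
    moreover have "h \<le> l - 3" if "X g c h \<in> C" using deg[OF that] nbr_conflict[OF _ c] by blast
    ultimately show ?thesis by blast
  qed
  \<comment> \<open>The same peeling, starting at a missing head and running along its path.\<close>
  have dead: "X g t h \<notin> C" if g: "g < G" and t: "t < q g" "t \<noteq> surv g" for g t h
  proof (induction h)
    case (Suc h)
    then show ?case
      using deg[of "X g t (Suc h)" "if Suc h = L g - 2 then W (wpos g t) else X g t (Suc (Suc h))"]
        nbr_path[OF _ t(1), of "Suc h"] by fastforce
  qed (use avoid g t in blast)
  have inC: "g < G \<and> c = surv g \<and> h \<le> L g - 2" if x: "X g c h \<in> C" for g c h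
  proof -
    obtain y where y: "y \<in> C" "{X g c h, y} \<in> EE" using deg[OF x] by blast
    show ?thesis using nbr_X[OF y(2)] conflict dead x by blast
  qed
  define prv where "prv g h = (if h = 0 then U (upos g (surv g)) else X g (surv g) (h - 1))" for g h
  define nxt where "nxt g h = (if h = L g - 2 then W (wpos g (surv g)) else X g (surv g) (Suc h))" for g h
  \<comment> \<open>The edges from a surviving head to other heads and to closing rows lead out of
    \<open>C\<close>. So every remaining inner vertex has just two possible neighbours, and by
    \<open>deg\<close> both are in \<open>C\<close>.\<close>
  have nbr: "y = prv g h \<or> y = nxt g h" if g: "g < G" and y: "y \<in> C" "{X g (surv g) h, y} \<in> EE" for g h y
  proof (cases "h = 0")
    case True
    have "2 \<le> L g" using sl by blast
    then have L: "L g = 2 \<longleftrightarrow> L g - 2 = 0" by linarith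
    show ?thesis
      using nbr_head[OF _ surv[OF g], of y] y True dead[OF g, of _ 0] conflict[OF _ g] L
      unfolding prv_def nxt_def by auto
  next
    case False
    then show ?thesis using nbr_path[OF y(2) surv[OF g]] by (auto simp: prv_def nxt_def)
  qed
  have both: "prv g h \<in> C \<and> nxt g h \<in> C" if g: "g < G" and x: "X g (surv g) h \<in> C" for g h
    using deg[OF x, of "prv g h"] deg[OF x, of "nxt g h"] nbr[OF g] by metis
  \<comment> \<open>A surviving path lies in \<open>C\<close> together with both ends as soon as one
    of its inner vertices does; the head serves as witness.\<close>
  define on where "on g \<longleftrightarrow> g < G \<and> X g (surv g) 0 \<in> C" for g
  have down: "X g (surv g) h \<in> C \<Longrightarrow> g < G \<Longrightarrow> X g (surv g) 0 \<in> C" for g h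
  proof (induction h)
    case (Suc h)
    then show ?case using both[of g "Suc h"] by (simp add: prv_def)
  qed simp
  have up: "h \<le> L g - 2 \<Longrightarrow> X g (surv g) h \<in> C" if "on g" for g h
  proof (induction h)
    case (Suc h)
    then show ?case using both[of g h] that by (auto simp: nxt_def on_def)
  qed (use that on_def in blast)
  have onU: "U (upos g (surv g)) \<in> C" if "on g" for g
    using both[of g 0] that by (auto simp: prv_def on_def)
  have onW: "W (wpos g (surv g)) \<in> C" if "on g" for g
    using both[of g "L g - 2"] that up[OF that order_refl] by (auto simp: nxt_def on_def)
  \<comment> \<open>Each gadget offers a core vertex at most one neighbour in \<open>C\<close>, so
    degree two yields a path of a gadget other than \<open>g0\<close>.\<close>
  have atU: "\<exists>g. on g \<and> upos g (surv g) = i \<and> g \<noteq> g0" if "U i \<in> C" for i g0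
  proof -
    obtain y where y: "y \<in> C" "{U i, y} \<in> EE" "y \<noteq> X g0 (surv g0) 0" using deg[OF \<open>U i \<in> C\<close>] by metis
    obtain g t where "g < G" "t < q g" "y = X g t 0" "upos g t = i" using nbr_U[OF y(2)] by blast
    with y inC[of g t 0] show ?thesis unfolding on_def by blast
  qed
  have atW: "\<exists>g. on g \<and> wpos g (surv g) = j \<and> g \<noteq> g0" if "W j \<in> C" for j g0
  proof -
    obtain y where y: "y \<in> C" "{W j, y} \<in> EE" "y \<noteq> X g0 (surv g0) (L g0 - 2)" using deg[OF \<open>W j \<in> C\<close>] by metis
    obtain g t where "g < G" "t < q g" "y = X g t (L g - 2)" "wpos g t = j" using nbr_W[OF y(2)] by blast
    with y inC[of g t "L g - 2"] down[of g "L g - 2"] show ?thesis unfolding on_def by blast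
  qed
  define P where "P g = (\<lambda>h. X g (surv g) h) ` {..<L g - 1}" for g
  have P: "P g \<subseteq> C" "card (P g) = L g - 1" "finite (P g)" if "on g" for g
  proof -
    show "P g \<subseteq> C" using up[OF that] unfolding P_def by auto
    show "card (P g) = L g - 1" unfolding P_def by (subst card_image) (auto simp: inj_on_def)
  qed (simp add: P_def)
  \<comment> \<open>Two parallel paths with their common ends have
    \<open>2 * (l - short_len l)\<close> vertices.\<close>
  have two: ?thesis if g: "on g" "on g'" "g \<noteq> g'" "upos g (surv g) = upos g' (surv g')"
      "wpos g (surv g) = wpos g' (surv g')" for g g'
  proof -
    have "pos (gs ! g ! surv g) = pos (gs ! g' ! surv g')"
      using g(4,5) by (simp add: upos_def wpos_def prod_eq_iff)
    then have "q g = 3" "q g' = 3" using parallel g by (auto simp: on_def)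
    then have L: "L g = l - short_len l" "L g' = l - short_len l" by (simp_all add: path_len_def)
    let ?D = "P g \<union> P g' \<union> {U (upos g (surv g)), W (wpos g (surv g))}"
    have "card ?D = card (P g) + card (P g') + 2"
      using P(3)[OF g(1)] P(3)[OF g(2)] g(3)
      by (subst card_Un_disjoint; (subst card_Un_disjoint)?) (auto simp: P_def)
    moreover have "?D \<subseteq> C" using P(1) onU onW g by auto
    then have "card ?D \<le> card C" using fin by (rule card_mono[rotated])
    ultimately show ?thesis using P(2)[OF g(1)] P(2)[OF g(2)] L sl by linarith
  qed
  obtain i where i: "U i \<in> C"
  proof -
    obtain x where x: "x \<in> C" using ne by blast
    show thesis
    proof (cases x)
      case (U i)
      with x that show ?thesis by blast
    next
      case (W j)
      with x atW[of j] onU that show ?thesis by blast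
    next
      case (X g c h)
      with x inC[of g c h] down[of g h] onU[of g] that show ?thesis unfolding on_def by blast
    qed
  qed
  obtain g1 where g1: "on g1" "upos g1 (surv g1) = i" using atU[OF i] by blast
  obtain g2 where g2: "on g2" "upos g2 (surv g2) = i" "g2 \<noteq> g1" using atU[OF i] by blast
  define j1 j2 where "j1 = wpos g1 (surv g1)" and "j2 = wpos g2 (surv g2)"
  show ?thesis
  proof (cases "j1 = j2")
    case True
    then show ?thesis using two[of g1 g2] g1 g2 by (simp add: j1_def j2_def)
  next
    case False
    \<comment> \<open>The ends \<open>j1\<close> and \<open>j2\<close> differ, and each carries a
      further path. If \<open>g3\<close> led back to \<open>i\<close>, it would be parallel to
      \<open>g1\<close>; otherwise there are four distinct paths and four distinct core vertices, at
      least \<open>4 * short_len l\<close> vertices in all.\<close>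
    obtain g3 where g3: "on g3" "wpos g3 (surv g3) = j1" "g3 \<noteq> g1"
      using atW[OF onW[OF g1(1)], of g1] unfolding j1_def by blast
    obtain g4 where g4: "on g4" "wpos g4 (surv g4) = j2" "g4 \<noteq> g2"
      using atW[OF onW[OF g2(1)], of g2] unfolding j2_def by blast
    define i3 where "i3 = upos g3 (surv g3)"
    show ?thesis
    proof (cases "i3 = i")
      case True
      then show ?thesis using two[of g1 g3] g1 g3 by (simp add: j1_def i3_def)
    next
      case i3: False
      have d: "g1 \<noteq> g2" "g1 \<noteq> g3" "g1 \<noteq> g4" "g2 \<noteq> g3" "g2 \<noteq> g4" "g3 \<noteq> g4"
        using False g2 g3 g4 by (auto simp: j1_def j2_def)
      let ?D = "P g1 \<union> (P g2 \<union> (P g3 \<union> (P g4 \<union> {U i, U i3, W j1, W j2})))"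
      have D: "P g1 \<inter> (P g2 \<union> (P g3 \<union> (P g4 \<union> {U i, U i3, W j1, W j2}))) = {}"
        "P g2 \<inter> (P g3 \<union> (P g4 \<union> {U i, U i3, W j1, W j2})) = {}"
        "P g3 \<inter> (P g4 \<union> {U i, U i3, W j1, W j2}) = {}"
        "P g4 \<inter> {U i, U i3, W j1, W j2} = {}"
        using d by (auto simp: P_def)
      have F: "finite (P g)" for g by (simp add: P_def)
      have "card ?D = card (P g1) + (card (P g2) + (card (P g3) + (card (P g4) + 4)))"
      proof -
        have "card {U i, U i3, W j1, W j2} = 4" using i3 False by simp
        then show ?thesis by (simp only: card_Un_disjoint D F finite_Un finite.intros simp_thms)
      qed
      moreover have "?D \<subseteq> C"
        using P(1)[OF g1(1)] P(1)[OF g2(1)] P(1)[OF g3(1)] P(1)[OF g4(1)] i onU[OF g3(1)] onW[OF g1(1)] onW[OF g2(1)]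
        by (simp add: i3_def j1_def j2_def)
      then have "card ?D \<le> card C" using fin by (rule card_mono[rotated])
      moreover have "short_len l \<le> L g" for g using sl by (simp add: path_len_def)
      from this[of g1] this[of g2] this[of g3] this[of g4] have
        "4 * short_len l \<le> (L g1 - 1) + ((L g2 - 1) + ((L g3 - 1) + ((L g4 - 1) + 4)))" by linarith
      ultimately show ?thesis using P(2)[OF g1(1)] P(2)[OF g2(1)] P(2)[OF g3(1)] P(2)[OF g4(1)] sl by linarith
    qed
  qed
qed

section \<open>Cycles that force deletions\<close>

lemma arcI:
  assumes "(u, v) \<in> set (template l (q g))"
  shows "arc g (inst g (gs ! g) u) (inst g (gs ! g) v)"
  using assms unfolding arc_def gadget_edges_def by force

lemma conflict_arcs:
  assumes "(c, t, t') \<in> set (conflicts (q g))"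
  shows "arc g (X g t 0) (X g t' 0)" "arc g (X g t 0) (X g c 0)" "arc g (X g t' 0) (X g c (l - 3))"
    "h < l - 3 \<Longrightarrow> arc g (X g c h) (X g c (Suc h))"
proof -
  show "arc g (X g t 0) (X g t' 0)"
    using assms arcI[of "SX t 0" "SX t' 0" g] by (auto simp: mem_template)
  show "arc g (X g t 0) (X g c 0)"
    using assms arcI[of "SX t 0" "SX c 0" g] by (auto simp: mem_template)
  show "arc g (X g t' 0) (X g c (l - 3))"
    using assms arcI[of "SX t' 0" "SX c (l - 3)" g] by (auto simp: mem_template)
  show "h < l - 3 \<Longrightarrow> arc g (X g c h) (X g c (Suc h))"
    using assms arcI[of "SX c h" "SX c (Suc h)" g] by (auto simp: mem_template)
qed

lemma path_arcs:
  assumes "t < q g"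
  shows "arc g (U (upos g t)) (X g t 0)" "arc g (W (wpos g t)) (X g t (L g - 2))"
    "h < L g - 2 \<Longrightarrow> arc g (X g t h) (X g t (Suc h))"
proof -
  show "arc g (U (upos g t)) (X g t 0)"
    using assms arcI[of "SU t" "SX t 0" g] by (auto simp: mem_template upos_def)
  show "arc g (W (wpos g t)) (X g t (L g - 2))"
    using assms arcI[of "SW t" "SX t (L g - 2)" g] by (auto simp: mem_template wpos_def)
  show "h < L g - 2 \<Longrightarrow> arc g (X g t h) (X g t (Suc h))"
    using assms arcI[of "SX t h" "SX t (Suc h)" g] by (auto simp: mem_template)
qed

lemma conflict_cycle:
  assumes g: "g < G" and c: "(c, t, t') \<in> set (conflicts (q g))"
  shows "is_cycle EE (X g t 0 # map (X g c) [0..<l - 2] @ [X g t' 0])"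
proof (rule is_cycleI)
  have E: "{x, y} \<in> EE" if "arc g x y \<or> arc g y x" for x y using that g EE_iff by blast
  have ne: "t \<noteq> t'" "t \<noteq> c" "t' \<noteq> c" using conflictsD[OF c] by auto
  then show "distinct (X g t 0 # map (X g c) [0..<l - 2] @ [X g t' 0])"
    by (auto simp: distinct_map inj_on_def)
  have "hd (map (X g c) [0..<l - 2]) = X g c 0" "last (map (X g c) [0..<l - 2]) = X g c (l - 3)"
    using l5 by (simp_all add: hd_map last_map last_upt hd_upt)
  moreover have "{X g t 0, X g c 0} \<in> EE" "{X g c (l - 3), X g t' 0} \<in> EE"
    "\<And>h. h < l - 3 \<Longrightarrow> {X g c h, X g c (Suc h)} \<in> EE"
    using conflict_arcs[OF c] by (blast intro: E)+
  ultimately show "successively (\<lambda>x y. {x, y} \<in> EE) (X g t 0 # map (X g c) [0..<l - 2] @ [X g t' 0])"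
    using l5 by (simp add: successively_Cons successively_append_iff successively_map successively_upt)
  show "{last (X g t 0 # map (X g c) [0..<l - 2] @ [X g t' 0]), hd (X g t 0 # map (X g c) [0..<l - 2] @ [X g t' 0])} \<in> EE"
    using E[of "X g t' 0" "X g t 0"] conflict_arcs(1)[OF c] by simp
qed (use l5 in simp)

text \<open>Equal positions give the two paths the same ends; the clause path is traversed backwards
  from \<open>W\<close> to \<open>U\<close>. The number of vertices is
  \<open>1 + (L g - 1) + 1 + (L g' - 1) = l\<close>.\<close>

lemma variable_clause_cycle:
  assumes g: "g < G" "g' < G" "q g = 2" "q g' = 3" and t: "t < q g" "t' < q g'"
    and p: "pos (gs ! g ! t) = pos (gs ! g' ! t')"
  shows "is_cycle EE (U (upos g t) # map (X g t) [0..<L g - 1] @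
     W (wpos g t) # rev (map (X g' t') [0..<L g' - 1]))" (is "is_cycle EE ?vs")
proof (rule is_cycleI)
  have L: "L g \<ge> 2" "L g' \<ge> 2" using short_len[OF l5] by blast+
  have up: "upos g' t' = upos g t" "wpos g' t' = wpos g t" using p by (simp_all add: upos_def wpos_def)
  have E: "{x, y} \<in> EE" if "r < G" "arc r x y \<or> arc r y x" for r x y using that EE_iff by blast
  have path: "{U (upos r s), X r s 0} \<in> EE" "{X r s (L r - 2), W (wpos r s)} \<in> EE"
    "\<And>h. h < L r - 2 \<Longrightarrow> {X r s h, X r s (Suc h)} \<in> EE" if "r < G" "s < q r" for r s
    using path_arcs[OF that(2)] by (blast intro: E[OF that(1)])+
  have hl: "hd (map (X r s) [0..<L r - 1]) = X r s 0" "last (map (X r s) [0..<L r - 1]) = X r s (L r - 2)"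
    if "L r \<ge> 2" for r s
    using that by (simp_all add: hd_map last_map hd_upt last_upt numeral_2_eq_2)
  have nil: "map (X r s) [0..<L r - 1] \<noteq> []" if "L r \<ge> 2" for r s using that by simp
  show "distinct ?vs" using g by (auto simp: distinct_map inj_on_def)
  note P = path[OF g(1) t(1)] path[OF g(2) t(2), unfolded up]
  have "successively (\<lambda>x y. {x, y} \<in> EE) (map (X g t) [0..<L g - 1])"
    "successively (\<lambda>x y. {x, y} \<in> EE) (rev (map (X g' t') [0..<L g' - 1]))"
    using P(3,6) by (auto simp: successively_rev successively_map successively_upt insert_commute)
  then show "successively (\<lambda>x y. {x, y} \<in> EE) ?vs"
    using P hl[OF L(1), of t] hl[OF L(2), of t'] nil[OF L(1), of t] nil[OF L(2), of t']
    by (simp add: successively_Cons successively_append_iff hd_append hd_rev insert_commute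
        del: map_is_Nil_conv)
  show "{last ?vs, hd ?vs} \<in> EE"
    using P(4) hl[OF L(2), of t'] nil[OF L(2), of t']
    by (simp add: last_rev insert_commute del: map_is_Nil_conv)
  show "3 \<le> length ?vs" using L by simp
qed

definition budget :: nat where "budget = (\<Sum>g<G. q g - 1)"

text \<open>Tight counting: the sets \<open>A g\<close> are disjoint and each requires
  \<open>q g - 1\<close> deletions, so a budget equal to the sum leaves nothing over. Every gadget
  receives exactly its share, and \<open>S\<close> is contained in the union of the
  \<open>A g\<close>.\<close>

lemma deletion_structure:
  assumes S: "finite S" "card S \<le> budget"
    and hit: "\<And>vs. is_cycle EE vs \<Longrightarrow> length vs = l \<Longrightarrow> set vs \<inter> S \<noteq> {}"
  shows "\<And>g. g < G \<Longrightarrow> \<exists>t<q g. X g t 0 \<notin> S"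
    "\<And>g g' t t'. \<lbrakk>g < G; g' < G; q g = 2; q g' = 3; t < q g; t' < q g'; pos (gs ! g ! t) = pos (gs ! g' ! t')\<rbrakk> \<Longrightarrow>
       X g t 0 \<in> S \<or> X g' t' 0 \<in> S"
proof -
  \<comment> \<open>\<open>A g\<close> contains the heads and the closing rows, but neither core
    vertices nor later path vertices. Hence a cycle made of a variable path and a clause path can
    meet \<open>S\<close> only in the two heads.\<close>
  define A where "A g = (\<lambda>t. X g t 0) ` {..<q g} \<union> (\<lambda>(c, h). X g c h) ` ({3..<6} \<times> {..<l})" for g
  have fin: "finite (A g)" for g by (simp add: A_def)
  have disj: "A g \<inter> A g' = {}" if "g \<noteq> g'" for g g' using that by (auto simp: A_def)
  have lower: "q g - 1 \<le> card (S \<inter> A g)" if g: "g < G" for g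
  proof -
    have hit': "\<exists>x\<in>S \<inter> A g. x \<in> {X g t 0, X g t' 0} \<union> range (X g c)" if c: "(c, t, t') \<in> set (conflicts (q g))" for c t t'
    proof -
      have "set (X g t 0 # map (X g c) [0..<l - 2] @ [X g t' 0]) \<inter> S \<noteq> {}"
        by (rule hit[OF conflict_cycle[OF g c]]) (use l5 in simp)
      then obtain x where x: "x \<in> set (X g t 0 # map (X g c) [0..<l - 2] @ [X g t' 0])" "x \<in> S" by blast
      moreover have "set (X g t 0 # map (X g c) [0..<l - 2] @ [X g t' 0]) \<subseteq> A g"
        using conflictsD[OF c] by (auto simp: A_def image_iff)
      ultimately have "x \<in> S \<inter> A g" by blast
      moreover have "x \<in> {X g t 0, X g t' 0} \<union> range (X g c)" using x(1) by auto
      ultimately show ?thesis by blast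
    qed
    have f: "finite (S \<inter> A g)" using S by simp
    consider "q g = 2" | "q g = 3" using gs_length[OF g] by blast
    then show ?thesis
    proof cases
      case 1
      then have "S \<inter> A g \<noteq> {}" using hit'[of 3 0 1] by (auto simp: mem_conflicts)
      with f 1 show ?thesis by (simp add: Suc_leI card_gt_0_iff)
    next
      case 2
      \<comment> \<open>Any two of the three private cycles share a head, but no vertex lies on all
        three, so one deletion cannot suffice.\<close>
      obtain x y z where x: "x \<in> S \<inter> A g" "x \<in> {X g 0 0, X g 1 0} \<union> range (X g 3)"
        and y: "y \<in> S \<inter> A g" "y \<in> {X g 0 0, X g 2 0} \<union> range (X g 4)"
        and z: "z \<in> S \<inter> A g" "z \<in> {X g 1 0, X g 2 0} \<union> range (X g 5)"
        using hit'[of 3 0 1] hit'[of 4 0 2] hit'[of 5 1 2] 2 by (force simp: mem_conflicts)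
      have "\<not> (x = y \<and> y = z)" using x(2) y(2) z(2) by auto
      then have "\<exists>u v. u \<noteq> v \<and> {u, v} \<subseteq> S \<inter> A g" using x(1) y(1) z(1) by blast
      then obtain u v where uv: "u \<noteq> v" "{u, v} \<subseteq> S \<inter> A g" by blast
      then have "card {u, v} \<le> card (S \<inter> A g)" using f by (intro card_mono)
      with uv 2 show ?thesis by simp
    qed
  qed
  let ?U = "\<Union>g<G. S \<inter> A g"
  have cU: "card ?U = (\<Sum>g<G. card (S \<inter> A g))"
    using disj fin by (intro card_UN_disjoint) auto
  have "budget \<le> (\<Sum>g<G. card (S \<inter> A g))"
    unfolding budget_def by (rule sum_mono) (use lower in simp)
  moreover have "?U \<subseteq> S" by blast
  then have "card ?U \<le> card S" using S(1) by (rule card_mono[rotated])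
  ultimately have eq: "card ?U = card S" "(\<Sum>g<G. q g - 1) = (\<Sum>g<G. card (S \<inter> A g))"
    using S(2) cU unfolding budget_def by linarith+
  have sub: "S = ?U" using card_subset_eq[OF S(1) _ eq(1)] by blast
  have exact: "card (S \<inter> A g) = q g - 1" if "g < G" for g
    using sum_mono_inv[OF eq(2)] lower that by (metis finite_lessThan lessThan_iff)
  show survivor: "\<exists>t<q g. X g t 0 \<notin> S" if g: "g < G" for g
  proof (rule ccontr)
    assume "\<not> ?thesis"
    then have "(\<lambda>t. X g t 0) ` {..<q g} \<subseteq> S \<inter> A g" by (auto simp: A_def)
    then have "card ((\<lambda>t. X g t 0) ` {..<q g}) \<le> card (S \<inter> A g)" using S(1) by (intro card_mono) auto
    moreover have "card ((\<lambda>t. X g t 0) ` {..<q g}) = q g" by (simp add: card_image inj_on_def)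
    ultimately have "q g \<le> q g - 1" using exact[OF g] by linarith
    then show False using gs_length[OF g] by auto
  qed
  fix g g' t t'
  assume g: "g < G" "g' < G" "q g = 2" "q g' = 3" and t: "t < q g" "t' < q g'"
    and p: "pos (gs ! g ! t) = pos (gs ! g' ! t')"
  let ?vs = "U (upos g t) # map (X g t) [0..<L g - 1] @ W (wpos g t) # rev (map (X g' t') [0..<L g' - 1])"
  have "L g = short_len l" "L g' = l - short_len l" using g by (simp_all add: path_len_def)
  then have "length ?vs = l" using short_len[OF l5] by simp
  from hit[OF variable_clause_cycle[OF g t p] this] obtain x where x: "x \<in> set ?vs" "x \<in> S" by blast
  from x(2) sub obtain r where r: "x \<in> A r" by blast
  have "t < 3" "t' < 3" using t g by auto
  with r x(1) have "x = X g t 0 \<or> x = X g' t' 0" by (auto simp: A_def)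
  with x(2) show "X g t 0 \<in> S \<or> X g' t' 0 \<in> S" by blast
qed

end


section \<open>The instance belonging to a formula\<close>

lemma is_cycle_induced: "is_cycle (induced_edges E Y) vs \<longleftrightarrow> is_cycle E vs \<and> set vs \<subseteq> Y"
proof
  assume *: "is_cycle (induced_edges E Y) vs"
  then have "set vs \<subseteq> Y"
    using is_cycle_neighbour[OF *] by (fastforce simp: induced_edges_def)
  with * show "is_cycle E vs \<and> set vs \<subseteq> Y" by (auto simp: is_cycle_def induced_edges_def)
next
  assume *: "is_cycle E vs \<and> set vs \<subseteq> Y"
  have "vs ! i \<in> Y" if "i < length vs" for i using * that by auto
  moreover have "Suc i mod length vs < length vs" if "i < length vs" for i
    using that by (intro mod_less_divisor) linarith
  ultimately show "is_cycle (induced_edges E Y) vs"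
    using * unfolding is_cycle_def induced_edges_def by simp
qed

text \<open>Both problems at once, with the forbidden lengths as a predicate. Forbidding more
  lengths is the stronger demand, which links the two problems.\<close>

definition deletion :: "(nat \<Rightarrow> bool) \<Rightarrow> 'a set \<Rightarrow> 'a set set \<Rightarrow> int \<Rightarrow> bool" where
  "deletion P V E k \<longleftrightarrow> (\<exists>S\<subseteq>V. int (card S) \<le> k \<and>
     \<not> (\<exists>vs. is_cycle E vs \<and> set vs \<subseteq> V - S \<and> P (length vs)))"

lemma cycle_vertex_deletion_eq: "cycle_vertex_deletion l = deletion (\<lambda>m. m = l)"
  and girth_vertex_deletion_eq: "girth_vertex_deletion l = deletion (\<lambda>m. m \<le> l)"
  by (auto simp: fun_eq_iff cycle_vertex_deletion_def girth_vertex_deletion_def deletion_def is_cycle_induced)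

lemma deletion_mono: "deletion P V E k \<Longrightarrow> (\<And>m. Q m \<Longrightarrow> P m) \<Longrightarrow> deletion Q V E k"
  unfolding deletion_def by blast

lemma deletion_image_imp:
  assumes f: "inj_on f V" and E: "\<And>e. e \<in> E \<Longrightarrow> e \<subseteq> V" and d: "deletion P V E k"
  shows "deletion P (f ` V) ((`) f ` E) k"
proof -
  obtain S where S: "S \<subseteq> V" "int (card S) \<le> k"
    "\<And>vs. is_cycle E vs \<Longrightarrow> set vs \<subseteq> V - S \<Longrightarrow> \<not> P (length vs)"
    using d unfolding deletion_def by blast
  have "\<not> P (length vs)" if vs: "is_cycle ((`) f ` E) vs" "set vs \<subseteq> f ` V - f ` S" for vs
  proof -
    have "set vs \<subseteq> f ` (V - S)" using vs(2) inj_on_image_set_diff[OF f _ S(1), of V] by auto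
    then have inv: "inv_into (V - S) f x \<in> V - S \<and> f (inv_into (V - S) f x) = x" if "x \<in> set vs" for x
      using that by (meson f_inv_into_f inv_into_into subsetD)
    obtain us where us: "vs = map f us" "set us \<subseteq> V - S"
    proof
      show "vs = map f (map (inv_into (V - S) f) vs)" using inv by (simp add: map_idI)
      show "set (map (inv_into (V - S) f) vs) \<subseteq> V - S" using inv by auto
    qed
    have "{x, y} \<in> E" if xy: "x \<in> V" "y \<in> V" "{f x, f y} \<in> (`) f ` E" for x y
    proof -
      obtain e where e: "e \<in> E" "f ` {x, y} = f ` e" using xy(3) by auto
      then have "{x, y} = e" using inj_on_image_eq_iff[OF f, of "{x, y}" e] E[OF e(1)] xy by auto
      with e show ?thesis by simp
    qed
    moreover have "us ! i \<in> V" if "i < length us" for i using us(2) nth_mem[OF that] by blast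
    moreover have "Suc i mod length us < length us" if "i < length us" for i
      using that by (intro mod_less_divisor) linarith
    ultimately have "is_cycle E us"
      using vs(1) unfolding is_cycle_def us(1) by (auto simp: distinct_map)
    from S(3)[OF this us(2)] us(1) show ?thesis by simp
  qed
  moreover have "card (f ` S) = card S" using S(1) f by (meson card_image inj_on_subset)
  ultimately show ?thesis unfolding deletion_def using S by (intro exI[of _ "f ` S"]) auto
qed

text \<open>One implication suffices; the converse is the same implication for
  \<open>inv_into V f\<close>.\<close>

lemma deletion_image:
  assumes f: "inj_on f V" and E: "\<And>e. e \<in> E \<Longrightarrow> e \<subseteq> V"
  shows "deletion P (f ` V) ((`) f ` E) k \<longleftrightarrow> deletion P V E k"
proof
  let ?g = "inv_into V f"
  have inv: "?g ` f ` e = e" if "e \<subseteq> V" for e using f that by (rule inv_into_image_cancel)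
  assume "deletion P (f ` V) ((`) f ` E) k"
  then have "deletion P (?g ` f ` V) ((`) ?g ` (`) f ` E) k"
    by (rule deletion_image_imp[rotated 2]) (use E in \<open>auto simp: inj_on_inv_into\<close>)
  moreover have "(`) ?g ` (`) f ` E = E" using inv E by (force simp: image_image)
  ultimately show "deletion P V E k" using inv[of V] by simp
qed (rule deletion_image_imp[OF f E])

text \<open>Variable \<open>v\<close> owns gadget \<open>v\<close>, whose node
  \<open>of_bool s\<close> carries the literal \<open>(v, s)\<close>; the clause gadgets
  follow.\<close>

definition gadgets :: "cnf3 \<Rightarrow> literal list list" where
  "gadgets = (\<lambda>(n, cs). map (\<lambda>v. [(v, False), (v, True)]) [0..<n] @ map (\<lambda>(x, y, z). [x, y, z]) cs)"

lemma length_gadgets [simp]: "length (gadgets (n, cs)) = n + length cs"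
  by (simp add: gadgets_def)

lemma gadgets_var: "g < n \<Longrightarrow> gadgets (n, cs) ! g = [(g, False), (g, True)]"
  by (simp add: gadgets_def nth_append)

lemma gadgets_clause: "i < length cs \<Longrightarrow> gadgets (n, cs) ! (n + i) = (\<lambda>(x, y, z). [x, y, z]) (cs ! i)"
  by (simp add: gadgets_def nth_append)

lemma length_gadgets_nth:
  assumes "g < n + length cs"
  shows "length (gadgets (n, cs) ! g) = (if g < n then 2 else 3)"
proof (cases "g < n")
  case False
  then show ?thesis using gadgets_clause[of "g - n" cs n] assms by (simp split: prod.splits)
qed (simp add: gadgets_var)

lemma valid_gadgets:
  assumes "valid_cnf3 (n, cs)" "g < n + length cs" "t < length (gadgets (n, cs) ! g)"
  shows "fst (gadgets (n, cs) ! g ! t) < n"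
proof (cases "g < n")
  case True
  then show ?thesis using assms(3) by (auto simp: gadgets_var less_2_cases_iff nth_Cons')
next
  case False
  with assms(2) have i: "g - n < length cs" by simp
  obtain u a v b w c where c: "cs ! (g - n) = ((u, a), (v, b), (w, c))" by (metis prod.exhaust)
  then have "((u, a), (v, b), (w, c)) \<in> set cs" using i nth_mem by metis
  then have "u < n" "v < n" "w < n" using assms(1) by (auto simp: valid_cnf3_def)
  then show ?thesis
    using gadgets_clause[OF i, of n] False c assms(3) by (auto simp: nth_Cons')
qed

lemma satisfiable_gadgets:
  "satisfiable_cnf3 (n, cs) \<longleftrightarrow> (\<exists>\<sigma>. \<forall>g. n \<le> g \<longrightarrow> g < n + length cs \<longrightarrow>
     (\<exists>t<3. \<sigma> (fst (gadgets (n, cs) ! g ! t)) = snd (gadgets (n, cs) ! g ! t)))"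
proof -
  have "(\<forall>((u, a), (v, b), (w, c)) \<in> set cs. \<sigma> u = a \<or> \<sigma> v = b \<or> \<sigma> w = c) \<longleftrightarrow>
    (\<forall>g. n \<le> g \<longrightarrow> g < n + length cs \<longrightarrow>
     (\<exists>t<3. \<sigma> (fst (gadgets (n, cs) ! g ! t)) = snd (gadgets (n, cs) ! g ! t)))" (is "?A \<longleftrightarrow> ?B") for \<sigma> :: "nat \<Rightarrow> bool"
  proof -
    have shift: "(\<forall>i<m. Q (n + i)) \<longleftrightarrow> (\<forall>g. n \<le> g \<longrightarrow> g < n + m \<longrightarrow> Q g)" for Q m
    proof safe
      fix g assume "\<forall>i<m. Q (n + i)" "n \<le> g" "g < n + m"
      from this(1)[rule_format, of "g - n"] this(2,3) show "Q g" by simp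
    qed simp
    have three: "(\<exists>t<3. P t) \<longleftrightarrow> P 0 \<or> P 1 \<or> P 2" for P :: "nat \<Rightarrow> bool"
      by (auto simp: less_Suc_eq numeral_3_eq_3 numeral_2_eq_2)
    have "?A \<longleftrightarrow> (\<forall>i<length cs. case cs ! i of ((u, a), (v, b), (w, c)) \<Rightarrow> \<sigma> u = a \<or> \<sigma> v = b \<or> \<sigma> w = c)"
      by (simp add: all_set_conv_all_nth case_prod_beta)
    also have "\<dots> \<longleftrightarrow> (\<forall>i<length cs. \<exists>t<3. \<sigma> (fst (gadgets (n, cs) ! (n + i) ! t)) = snd (gadgets (n, cs) ! (n + i) ! t))"
    proof (intro all_cong)
      fix i assume i: "i < length cs"
      obtain u a v b w c where c: "cs ! i = ((u, a), (v, b), (w, c))" by (metis prod.exhaust)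
      show "(case cs ! i of ((u, a), (v, b), (w, c)) \<Rightarrow> \<sigma> u = a \<or> \<sigma> v = b \<or> \<sigma> w = c) \<longleftrightarrow>
        (\<exists>t<3. \<sigma> (fst (gadgets (n, cs) ! (n + i) ! t)) = snd (gadgets (n, cs) ! (n + i) ! t))"
        unfolding three gadgets_clause[OF i] c by simp
    qed
    also have "\<dots> \<longleftrightarrow> ?B" by (rule shift)
    finally show ?thesis .
  qed
  then show ?thesis by (simp add: satisfiable_cnf3_def)
qed

locale reduction =
  fixes l n :: nat and cs :: "clause list"
  assumes l5: "l \<ge> 5" and valid: "valid_cnf3 (n, cs)"

sublocale reduction \<subseteq> gadget_graph l "gadgets (n, cs)"
  by unfold_locales (use l5 in \<open>auto simp: length_gadgets_nth\<close>)

context reduction begin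

text \<open>Literals have numbers below \<open>2 * n\<close>, so their coordinates are at most
  \<open>diag (2 * n)\<close>. The bound \<open>2 * n\<close> also covers \<open>n = 0\<close> and
  is what \<open>tree_pair\<close> computes from \<open>n\<close>.\<close>

definition M :: nat where "M = Suc (diag (2 * n))"

definition VV :: "vert set" where
  "VV = U ` {..<M} \<union> W ` {..<M} \<union> {X g c h | g c h. g < n + length cs \<and> c < 6 \<and> h < l}"

lemma pos_lt_M: "g < n + length cs \<Longrightarrow> t < q g \<Longrightarrow> upos g t < M \<and> wpos g t < M"
proof -
  assume "g < n + length cs" "t < q g"
  from valid_gadgets[OF valid this] obtain v s where vs: "gadgets (n, cs) ! g ! t = (v, s)" "v < n"
    by (metis prod.collapse)
  then have "2 * v + of_bool s \<le> 2 * n" by (cases s) auto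
  from mono_diag[OF this] show ?thesis
    by (simp add: M_def upos_def wpos_def pos_def vs diag_def)
qed

lemma arc_VV:
  assumes "arc g x y" "g < n + length cs"
  shows "x \<in> VV \<and> (\<exists>c h. y = X g c h \<and> c < 6 \<and> h < l) \<and> (\<forall>g' c h. x = X g' c h \<longrightarrow> g' = g)"
proof -
  have q: "q g \<le> 3" using length_gadgets_nth[OF assms(2)] by simp
  have L: "L g + 2 \<le> l" using short_len[OF l5] by blast
  have c: "c < 6" "t < 6" "t' < 6" if "(c, t, t') \<in> set (conflicts (q g))" for c t t'
    using conflictsD[OF that] by auto
  show ?thesis
    using assms q L l5 pos_lt_M[OF assms(2)] unfolding arc_iff
    by (elim disjE exE conjE) (force simp: VV_def dest: c)+
qed

lemma finite_VV: "finite VV"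
proof -
  have "{X g c h | g c h. g < n + length cs \<and> c < 6 \<and> h < l}
    = (\<lambda>(g, c, h). X g c h) ` ({..<n + length cs} \<times> {..<6} \<times> {..<l})" by force
  then show ?thesis by (simp add: VV_def)
qed

lemma EE_cases:
  assumes "e \<in> EE"
  obtains g x y where "g < n + length cs" "arc g x y" "e = {x, y}"
  using assms unfolding EE_def arc_def by auto

lemma EE_VV: "e \<in> EE \<Longrightarrow> e \<subseteq> VV"
proof (elim EE_cases)
  fix g x y assume g: "g < n + length cs" "arc g x y" "e = {x, y}"
  from arc_VV[OF g(2,1)] obtain c h where "x \<in> VV" "y = X g c h" "c < 6" "h < l" by blast
  moreover from this have "y \<in> VV" using g(1) by (simp add: VV_def)
  ultimately show "e \<subseteq> VV" using g(3) by simp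
qed

lemma satisfiable_imp_girth:
  assumes "satisfiable_cnf3 (n, cs)"
  shows "deletion (\<lambda>m. m \<le> l) VV EE (int budget)"
proof -
  let ?lit = "\<lambda>g t. gadgets (n, cs) ! g ! t"
  let ?G = "n + length cs"
  obtain \<sigma> where "\<And>g. n \<le> g \<Longrightarrow> g < ?G \<Longrightarrow> \<exists>t<3. \<sigma> (fst (?lit g t)) = snd (?lit g t)"
    using assms unfolding satisfiable_gadgets by blast
  then obtain \<tau> where \<tau>: "\<And>g. n \<le> g \<Longrightarrow> g < ?G \<Longrightarrow> \<tau> g < 3 \<and> \<sigma> (fst (?lit g (\<tau> g))) = snd (?lit g (\<tau> g))"
    by metis
  \<comment> \<open>A variable keeps the path of its false literal (node 0 is the negative one), a
    clause that of a true literal. So a variable path and a clause path that survive never share a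
    position.\<close>
  define surv where "surv g = (if g < n then if \<sigma> g then 0 else 1 else \<tau> g)" for g
  have surv: "surv g < q g" if "g < ?G" for g
    using \<tau>[of g] that by (auto simp: surv_def length_gadgets_nth)
  have var: "?lit g (surv g) = (g, \<not> \<sigma> g)" if "g < n" for g
    using that by (simp add: surv_def gadgets_var)
  have parallel: "q g = 3 \<and> q g' = 3"
    if g: "g < ?G" "g' < ?G" "g \<noteq> g'" and p: "pos (?lit g (surv g)) = pos (?lit g' (surv g'))" for g g'
  proof -
    have eq: "?lit g (surv g) = ?lit g' (surv g')" using p by (simp add: pos_inject)
    have "n \<le> g" "n \<le> g'"
      using eq g var[of g] var[of g'] \<tau>[of g] \<tau>[of g'] by (auto simp: surv_def split: if_splits)
    with g show ?thesis by (simp add: length_gadgets_nth)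
  qed
  define S where "S = (\<Union>g<?G. (\<lambda>t. X g t 0) ` ({..<q g} - {surv g}))"
  have "card S \<le> (\<Sum>g<?G. card ((\<lambda>t. X g t 0) ` ({..<q g} - {surv g})))"
    unfolding S_def by (rule card_UN_le) simp
  also have "\<dots> \<le> (\<Sum>g<?G. q g - 1)"
  proof (rule sum_mono)
    fix g assume "g \<in> {..<?G}"
    then have "card ({..<q g} - {surv g}) = q g - 1" using surv[of g] by simp
    then show "card ((\<lambda>t. X g t 0) ` ({..<q g} - {surv g})) \<le> q g - 1"
      by (metis card_image_le finite_Diff finite_lessThan)
  qed
  finally have card: "card S \<le> budget" by (simp add: budget_def)
  have "S \<subseteq> VV" using l5 by (auto simp: S_def VV_def length_gadgets_nth split: if_splits)
  moreover have "\<not> length vs \<le> l" if vs: "is_cycle EE vs" "set vs \<subseteq> VV - S" for vs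
  proof -
    have "l < card (set vs)"
    proof (rule min_degree_two_large[of surv])
      show "set vs \<noteq> {}" using vs(1) by (auto simp: is_cycle_def)
      show "\<And>x z. x \<in> set vs \<Longrightarrow> \<exists>y\<in>set vs. {x, y} \<in> EE \<and> y \<noteq> z"
        by (rule is_cycle_neighbour[OF vs(1)])
      show "X g t 0 \<notin> set vs" if "g < length (gadgets (n, cs))" "t < q g" "t \<noteq> surv g" for g t
        using that vs(2) by (auto simp: S_def)
    qed (use surv parallel in auto)
    then show ?thesis using vs(1) by (simp add: is_cycle_def distinct_card)
  qed
  ultimately show ?thesis using card unfolding deletion_def by (intro exI[of _ S]) auto
qed

lemma cycle_imp_satisfiable:
  assumes "deletion (\<lambda>m. m = l) VV EE (int budget)"
  shows "satisfiable_cnf3 (n, cs)"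
proof -
  let ?lit = "\<lambda>g t. gadgets (n, cs) ! g ! t"
  let ?G = "n + length cs"
  obtain S where S: "S \<subseteq> VV" "card S \<le> budget"
    "\<And>vs. is_cycle EE vs \<Longrightarrow> set vs \<subseteq> VV - S \<Longrightarrow> length vs \<noteq> l"
    using assms unfolding deletion_def by auto
  have fin: "finite S" using S(1) finite_VV finite_subset by blast
  have hit: "set vs \<inter> S \<noteq> {}" if vs: "is_cycle EE vs" "length vs = l" for vs
  proof -
    have "set vs \<subseteq> VV"
    proof
      fix x assume "x \<in> set vs"
      from is_cycle_neighbour[OF vs(1) this] obtain y where "{x, y} \<in> EE" by blast
      from EE_VV[OF this] show "x \<in> VV" by simp
    qed
    with S(3)[OF vs(1)] vs(2) show ?thesis by blast
  qed
  note ds = deletion_structure[OF fin S(2) hit]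
  \<comment> \<open>A literal is true when the head of its variable path is deleted; node 1 is the
    positive literal.\<close>
  define \<sigma> where "\<sigma> v \<longleftrightarrow> X v 1 0 \<in> S" for v
  have "\<exists>t<3. \<sigma> (fst (?lit g t)) = snd (?lit g t)" if g: "n \<le> g" "g < ?G" for g
  proof -
    obtain t where t: "t < 3" "X g t 0 \<notin> S"
      using ds(1)[of g] g by (auto simp: length_gadgets_nth)
    obtain v s where vs: "?lit g t = (v, s)" by (metis prod.exhaust)
    have v: "v < n" using valid_gadgets[OF valid g(2), of t] g t vs by (simp add: length_gadgets_nth)
    \<comment> \<open>The surviving clause path forces the head of the same literal to be deleted in
      the variable gadget, where the opposite head must then survive.\<close>
    have "X v (of_bool s) 0 \<in> S"
      using ds(2)[of v g "of_bool s" t] v g t vs by (auto simp: length_gadgets_nth gadgets_var)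
    moreover have "X v 0 0 \<notin> S \<or> X v 1 0 \<notin> S"
      using ds(1)[of v] v by (auto simp: length_gadgets_nth less_2_cases_iff)
    ultimately have "\<sigma> v = s" by (cases s) (auto simp: \<sigma>_def)
    with t(1) vs show ?thesis by (intro exI[of _ t]) simp
  qed
  then show ?thesis unfolding satisfiable_gadgets by blast
qed

section \<open>Numbering, edge list and path decomposition\<close>

fun num :: "vert \<Rightarrow> nat" where
  "num (U i) = 2 * i"
| "num (W j) = Suc (2 * j)"
| "num (X g c h) = 2 * M + 6 * l * g + (c * l + h)"

lemma inside_block: "c < 6 \<Longrightarrow> h < l \<Longrightarrow> c * l + h < 6 * l"
proof -
  assume "c < 6" "h < l"
  then have "Suc c * l \<le> 6 * l" by (intro mult_right_mono) auto
  with \<open>h < l\<close> show ?thesis unfolding mult_Suc by linarith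
qed

lemma block_unique:
  assumes "o1 < 6 * l" "o2 < 6 * l" "6 * l * g1 + o1 = 6 * l * g2 + o2"
  shows "g1 = g2 \<and> o1 = o2"
proof -
  have "(k * g + d) div k = g" if "d < k" for k g d :: nat using that by simp
  from this[OF assms(1), of g1] this[OF assms(2), of g2] have "g1 = g2" using assms(3) by simp
  with assms(3) show ?thesis by simp
qed

lemma num_inj: "inj_on num VV"
proof (rule inj_onI)
  fix x y assume xy: "x \<in> VV" "y \<in> VV" "num x = num y"
  have par: "2 * i \<noteq> Suc (2 * j)" for i j :: nat by presburger
  show "x = y"
  proof (cases x; cases y)
    fix g c h g' c' h' assume xx: "x = X g c h" "y = X g' c' h'"
    with xy have b: "c < 6" "h < l" "c' < 6" "h' < l" by (auto simp: VV_def)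
    have "g = g' \<and> c * l + h = c' * l + h'"
      by (rule block_unique) (use b inside_block xy(3) xx in auto)
    moreover from this have "(c * l + h) div l = (c' * l + h') div l" by simp
    then have "c = c'" using b by simp
    ultimately show ?thesis using xx by simp
  qed (use xy par par[symmetric] in \<open>auto simp: VV_def\<close>)
qed

lemma num_image: "num ` VV = {..<2 * M + 6 * l * (n + length cs)}"
proof (intro equalityI subsetI)
  fix u assume "u \<in> num ` VV"
  then obtain x where x: "x \<in> VV" "u = num x" by blast
  show "u \<in> {..<2 * M + 6 * l * (n + length cs)}"
  proof (cases x)
    case (X g c h)
    with x have b: "g < n + length cs" "c < 6" "h < l" by (auto simp: VV_def)
    then have "6 * l * Suc g \<le> 6 * l * (n + length cs)" by (intro mult_left_mono) auto
    with inside_block[OF b(2,3)] X x show ?thesis by simp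
  qed (use x in \<open>auto simp: VV_def\<close>)
next
  fix u assume u: "u \<in> {..<2 * M + 6 * l * (n + length cs)}"
  show "u \<in> num ` VV"
  proof (cases "u < 2 * M")
    case True
    then have "u = num (if even u then U (u div 2) else W (u div 2))"
      "(if even u then U (u div 2) else W (u div 2)) \<in> VV" by (auto simp: VV_def)
    then show ?thesis by (rule image_eqI)
  next
    case False
    define r where "r = u - 2 * M"
    have r: "u = 2 * M + r" "r < 6 * l * (n + length cs)" using False u by (auto simp: r_def)
    let ?x = "X (r div (6 * l)) (r mod (6 * l) div l) (r mod (6 * l) mod l)"
    have "r mod (6 * l) < 6 * l" using l5 by simp
    then have "r mod (6 * l) div l < 6" using l5 by (simp add: less_mult_imp_div_less)
    moreover have "r div (6 * l) < n + length cs"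
      using r(2) by (simp add: less_mult_imp_div_less mult.commute)
    ultimately have "?x \<in> VV" using l5 by (simp add: VV_def)
    moreover have "u = num ?x" by (simp add: r(1))
    ultimately show ?thesis by blast
  qed
qed

text \<open>The parameter counts the gadgets already emitted, and the reversal reflects a program
  that prepends to its output.\<close>

definition edge_list :: "nat \<Rightarrow> (nat \<times> nat) list" where
  "edge_list m = concat (map (\<lambda>g. map (map_prod num num) (gadget_edges g)) (rev [0..<m]))"

definition core :: "nat list" where "core = rev [0..<2 * M]"

definition bag :: "nat \<Rightarrow> nat list" where
  "bag g = map (\<lambda>d. 2 * M + 6 * l * g + d) [0..<6 * l] @ core"

text \<open>The final bag \<open>core\<close> is the initial value of the program's list; it covers
  the core even when there is no gadget.\<close>

definition bag_list :: "nat \<Rightarrow> nat list list" where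
  "bag_list m = rev (map bag [0..<m]) @ [core]"

definition instance_of :: pd_instance where
  "instance_of = (2 * M + 6 * l * (n + length cs), edge_list (n + length cs), int budget,
     bag_list (n + length cs))"

lemma edges_of_edge_list: "edges_of (edge_list (n + length cs)) = (`) num ` EE"
  by (simp add: edges_of_def edge_list_def EE_def image_UN image_image case_prod_beta atLeast0LessThan)

lemma deletion_instance:
  "deletion P {..<2 * M + 6 * l * (n + length cs)} (edges_of (edge_list (n + length cs))) k \<longleftrightarrow>
     deletion P VV EE k"
  unfolding edges_of_edge_list num_image[symmetric] by (rule deletion_image[OF num_inj EE_VV])

text \<open>Instances list edges with the smaller number first. The core precedes all private
  vertices, blocks are filled row by row, and closing rows come after path rows, so all arcs are
  increasing.\<close>

lemma num_arc:
  assumes "arc g x y" "g < n + length cs"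
  shows "num x < num y" "num x \<in> set (bag g)" "num y \<in> set (bag g)"
proof -
  obtain c h where y: "y = X g c h" "c < 6" "h < l" using arc_VV[OF assms] by blast
  have o: "num (X g c h) \<in> set (bag g)" if "c < 6" "h < l" for c h
    using inside_block[OF that] by (auto simp: bag_def)
  show "num y \<in> set (bag g)" using o y by simp
  have x: "x \<in> VV" "\<And>g' c h. x = X g' c h \<Longrightarrow> g' = g" using arc_VV[OF assms] by blast+
  show "num x \<in> set (bag g)"
  proof (cases x)
    case (X g' c' h')
    with x have "g' = g" "c' < 6" "h' < l" by (auto simp: VV_def)
    with X o show ?thesis by simp
  qed (use x(1) in \<open>auto simp: VV_def bag_def core_def\<close>)
  have col: "c * l + h < c' * l + h'" if "c < c'" "h < l" for c h c' h'
  proof -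
    have "Suc c * l \<le> c' * l" using that by (intro mult_right_mono) auto
    with that show ?thesis by simp
  qed
  show "num x < num y"
  proof (cases x)
    case (X g' c' h')
    with x(2) have g': "g' = g" by simp
    have q: "q g \<le> 3" using length_gadgets_nth[OF assms(2)] by simp
    have D: "t < d \<and> t' < d \<and> t < t'" if "(d, t, t') \<in> set (conflicts (q g))" for d t t'
      using conflictsD[OF that] by auto
    from assms(1) have "c' < c \<and> h' < l \<or> c' = c \<and> h' < h"
      using q l5 unfolding arc_iff X y(1) g' by (auto dest: D)
    then have "c' * l + h' < c * l + h" using col by auto
    then show ?thesis by (simp add: X y g')
  qed (use x(1) y in \<open>auto simp: VV_def\<close>)
qed

lemma distinct_concat_map:
  assumes "distinct xs" "\<And>x. x \<in> set xs \<Longrightarrow> distinct (f x)"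
    "\<And>x y. x \<in> set xs \<Longrightarrow> y \<in> set xs \<Longrightarrow> x \<noteq> y \<Longrightarrow> set (f x) \<inter> set (f y) = {}"
  shows "distinct (concat (map f xs))"
  using assms
proof (induction xs)
  case (Cons x xs)
  have "set (f x) \<inter> set (f y) = {}" if "y \<in> set xs" for y
    by (rule Cons.prems(3)) (use that Cons.prems(1) in auto)
  moreover have "distinct (concat (map f xs))"
    by (rule Cons.IH) (use Cons.prems in auto)
  ultimately show ?case using Cons.prems(2)[of x] by auto
qed simp

lemma distinct_template: "r \<le> 3 \<Longrightarrow> distinct (template l r)"
  unfolding template_def distinct_append
proof (intro conjI distinct_concat_map)
  assume r: "r \<le> 3"
  show "distinct (conflicts r)" by (simp add: conflicts_def)
  show "distinct (path_edges (path_len l r) t)" for t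
    by (auto simp: path_edges_def distinct_map inj_on_def)
  show "distinct (conflict_edges l c)" if "c \<in> set (conflicts r)" for c
  proof -
    obtain d t t' where c: "c = (d, t, t')" by (cases c)
    with that show ?thesis
      using conflictsD[of d t t' r] by (auto simp: conflict_edges_def distinct_map inj_on_def)
  qed
  show "set (path_edges (path_len l r) t) \<inter> set (path_edges (path_len l r) t') = {}" if "t \<noteq> t'" for t t'
    using that by (auto simp: path_edges_def)
  show "set (conflict_edges l c) \<inter> set (conflict_edges l c') = {}"
    if "c \<in> set (conflicts r)" "c' \<in> set (conflicts r)" "c \<noteq> c'" for c c'
  proof -
    obtain d t t' d' u u' where c: "c = (d, t, t')" "c' = (d', u, u')" by (cases c; cases c')
    with that show ?thesis by (auto simp: mem_conflicts mem_conflict_edges)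
  qed
  show "set (concat (map (path_edges (path_len l r)) [0..<r])) \<inter> set (concat (map (conflict_edges l) (conflicts r))) = {}"
    using r by (auto simp: mem_conflicts mem_conflict_edges mem_path_edges)
qed simp

text \<open>\<open>inst\<close> need not be injective: nodes of a clause may share a core vertex or
  even carry the same literal. Still, the private target of an arc determines the port at its other
  end, and also the gadget.\<close>

lemma distinct_edge_list: "distinct (edge_list (n + length cs))"
proof -
  have tmpl: "(\<exists>c h. v = SX c h) \<and> (\<forall>t. u = SU t \<longrightarrow> v = SX t 0) \<and> (\<forall>t. u = SW t \<longrightarrow> v = SX t (path_len l r - 2))"
    if "(u, v) \<in> set (template l r)" for u v r
    using that unfolding mem_template by auto
  have inj: "inj_on (map_prod (inst g xs) (inst g xs)) (set (template l r))" for g xs r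
  proof (rule inj_onI, clarify)
    fix u v u' v' assume t: "(u, v) \<in> set (template l r)" "(u', v') \<in> set (template l r)"
      and eq: "map_prod (inst g xs) (inst g xs) (u, v) = map_prod (inst g xs) (inst g xs) (u', v')"
    from tmpl[OF t(1)] tmpl[OF t(2)] eq show "u = u' \<and> v = v'"
      by (cases u; cases u') auto
  qed
  let ?es = "concat (map gadget_edges (rev [0..<n + length cs]))"
  have sub: "set ?es \<subseteq> VV \<times> VV"
    using EE_VV unfolding EE_def by fastforce
  have "distinct ?es"
  proof (rule distinct_concat_map)
    fix g assume "g \<in> set (rev [0..<n + length cs])"
    then show "distinct (gadget_edges g)"
      using inj distinct_template[of "q g"] by (simp add: gadget_edges_def distinct_map length_gadgets_nth)
  next
    fix g g' assume g: "g \<in> set (rev [0..<n + length cs])" "g' \<in> set (rev [0..<n + length cs])" "g \<noteq> g'"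
    show "set (gadget_edges g) \<inter> set (gadget_edges g') = {}"
    proof (rule ccontr)
      assume "set (gadget_edges g) \<inter> set (gadget_edges g') \<noteq> {}"
      then obtain x y where "arc g x y" "arc g' x y" unfolding arc_def by fast
      with arc_VV[of g x y] arc_VV[of g' x y] g show False by auto
    qed
  qed simp
  moreover have "inj_on (map_prod num num) (set ?es)"
    by (rule inj_on_subset[OF map_prod_inj_on[OF num_inj num_inj] sub])
  ultimately have "distinct (map (map_prod num num) ?es)" by (simp add: distinct_map)
  then show ?thesis by (simp add: edge_list_def map_concat comp_def)
qed

lemma set_core: "set core = {..<2 * M}" by (auto simp: core_def)

lemma set_bag: "set (bag g) = {..<2 * M} \<union> {2 * M + 6 * l * g..<2 * M + 6 * l * Suc g}"
proof -
  have "(\<lambda>d. 2 * M + 6 * l * g + d) ` {0..<6 * l} = {2 * M + 6 * l * g..<2 * M + 6 * l * Suc g}"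
    by (simp add: algebra_simps)
  then show ?thesis by (auto simp: bag_def set_core)
qed

lemma path_decomposition_instance:
  "path_decomposition {..<2 * M + 6 * l * (n + length cs)} (edges_of (edge_list (n + length cs)))
     (map set (bag_list (n + length cs)))"
  unfolding path_decomposition_def
proof (intro conjI ballI allI impI)
  let ?G = "n + length cs"
  have Suc_le: "6 * l * Suc g \<le> 6 * l * ?G" if "g < ?G" for g using that by (intro mult_left_mono) auto
  have len: "length (map set (bag_list ?G)) = Suc ?G" by (simp add: bag_list_def)
  have nth: "map set (bag_list ?G) ! i = (if i < ?G then set (bag (?G - 1 - i)) else {..<2 * M})" if "i < Suc ?G" for i
    using that by (auto simp: bag_list_def nth_append rev_nth set_core less_Suc_eq)
  show "map set (bag_list ?G) \<noteq> []" by (simp add: bag_list_def)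
  show "B \<subseteq> {..<2 * M + 6 * l * ?G}" if "B \<in> set (map set (bag_list ?G))" for B
    using that Suc_le by (fastforce simp: bag_list_def set_bag set_core)
  show "\<exists>B\<in>set (map set (bag_list ?G)). v \<in> B" if v: "v \<in> {..<2 * M + 6 * l * ?G}" for v
  proof -
    obtain x where x: "x \<in> VV" "v = num x" using v unfolding num_image[symmetric] by blast
    show ?thesis
    proof (cases x)
      case (X g c h)
      with x have b: "g < ?G" "c < 6" "h < l" by (auto simp: VV_def)
      then have "v \<in> set (bag g)" using X x(2) inside_block[OF b(2,3)] by (simp add: set_bag)
      with b(1) show ?thesis by (auto simp: bag_list_def)
    qed (use x in \<open>auto simp: VV_def bag_list_def set_core\<close>)
  qed
  show "\<exists>B\<in>set (map set (bag_list ?G)). e \<subseteq> B" if e: "e \<in> edges_of (edge_list ?G)" for e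
  proof -
    obtain g x y where g: "g < ?G" "arc g x y" "e = {num x, num y}"
      using e unfolding edges_of_edge_list EE_def arc_def by auto
    then have "e \<subseteq> set (bag g)" using num_arc[OF g(2,1)] by simp
    with g(1) show ?thesis by (auto simp: bag_list_def)
  qed
  fix v i j k assume *: "v \<in> {..<2 * M + 6 * l * ?G}" "i \<le> j" "j \<le> k"
    "k < length (map set (bag_list ?G))" "v \<in> map set (bag_list ?G) ! i" "v \<in> map set (bag_list ?G) ! k"
  show "v \<in> map set (bag_list ?G) ! j"
  proof (cases "v < 2 * M")
    case True
    then show ?thesis using * nth[of j] len by (auto simp: set_bag)
  next
    case False
    have ik: "i < Suc ?G" "k < Suc ?G" using * len by linarith+
    \<comment> \<open>Outside the core a number determines its block, hence its only bag.\<close>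
    have block: "m < ?G \<and> (\<exists>d<6 * l. v - 2 * M = 6 * l * (?G - 1 - m) + d)"
      if "m < Suc ?G" "v \<in> map set (bag_list ?G) ! m" for m
    proof -
      have m: "m < ?G" "v \<in> set (bag (?G - 1 - m))" using nth[OF that(1)] that(2) False by (auto split: if_splits)
      then have "v - 2 * M = 6 * l * (?G - 1 - m) + (v - 2 * M - 6 * l * (?G - 1 - m))"
        "v - 2 * M - 6 * l * (?G - 1 - m) < 6 * l"
        using False by (auto simp: set_bag)
      with m(1) show ?thesis by blast
    qed
    obtain d e where de: "i < ?G" "k < ?G" "d < 6 * l" "e < 6 * l"
      "6 * l * (?G - 1 - i) + d = 6 * l * (?G - 1 - k) + e"
      using block[OF ik(1) *(5)] block[OF ik(2) *(6)] by auto
    then have "?G - 1 - i = ?G - 1 - k" using block_unique by blast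
    with de(1,2) have "i = k" by linarith
    with * show ?thesis by simp
  qed
qed

lemma valid_instance: "valid_pd_instance instance_of"
proof -
  have "distinct b" if "b \<in> set (bag_list (n + length cs))" for b
    using that by (auto simp: bag_list_def bag_def core_def distinct_map inj_on_def)
  moreover have "u < v \<and> v < 2 * M + 6 * l * (n + length cs)" if uv: "(u, v) \<in> set (edge_list (n + length cs))" for u v
  proof -
    obtain g x y where g: "g < n + length cs" "arc g x y" "u = num x" "v = num y"
      using uv unfolding edge_list_def arc_def by auto
    have "y \<in> VV" using arc_VV[OF g(2,1)] g(1) by (auto simp: VV_def)
    then have "num y < 2 * M + 6 * l * (n + length cs)" using num_image by blast
    with num_arc[OF g(2,1)] g show ?thesis by simp
  qed
  ultimately show ?thesis
    using distinct_edge_list path_decomposition_instance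
    by (auto simp: valid_pd_instance_def instance_of_def)
qed

lemma pd_width_instance: "pd_width (map set (bag_list (n + length cs))) \<le> 2 * M + 6 * l"
proof -
  have "card B \<le> 2 * M + 6 * l" if "B \<in> set (map set (bag_list (n + length cs)))" for B
  proof -
    from that obtain b where b: "B = set b" "b \<in> set (bag_list (n + length cs))" by auto
    then have "length b \<le> 2 * M + 6 * l" by (auto simp: bag_list_def bag_def core_def)
    then show ?thesis using card_length[of b] unfolding b(1) by linarith
  qed
  then have "Max (card ` set (map set (bag_list (n + length cs)))) \<le> 2 * M + 6 * l"
    by (intro Max.boundedI) (auto simp: bag_list_def)
  then show ?thesis unfolding pd_width_def by linarith
qed

text \<open>With \<open>d = diag (2 * n)\<close>,
  \<open>d ^ 2 <= d * (d + 1) = 2 * triangle d <= 4 * n\<close>. The quadratic bound serves the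
  width, the linear one the graph size.\<close>

lemma M_bound: "M \<le> 2 * n + 1" "(M - 1) ^ 2 \<le> 4 * n"
proof -
  have "triangle (diag (2 * n)) \<le> 2 * n" by (rule triangle_diag_le)
  moreover have "2 * triangle (diag (2 * n)) = diag (2 * n) * Suc (diag (2 * n))"
    unfolding triangle_def by simp
  ultimately have "diag (2 * n) * Suc (diag (2 * n)) \<le> 4 * n" by linarith
  then show "(M - 1) ^ 2 \<le> 4 * n" by (simp add: M_def power2_eq_square)
  have "r \<le> triangle r" for r by (induction r) auto
  from this[of "diag (2 * n)"] triangle_diag_le[of "2 * n"] show "M \<le> 2 * n + 1" by (simp add: M_def)
qed

text \<open>A circle of implications: satisfiability gives a girth solution, which is a cycle
  solution, which gives satisfiability.\<close>

lemma solution_iff: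
  "cycle_vertex_deletion l {..<2 * M + 6 * l * (n + length cs)} (edges_of (edge_list (n + length cs))) (int budget)
     \<longleftrightarrow> satisfiable_cnf3 (n, cs)"
  "girth_vertex_deletion l {..<2 * M + 6 * l * (n + length cs)} (edges_of (edge_list (n + length cs))) (int budget)
     \<longleftrightarrow> satisfiable_cnf3 (n, cs)"
  unfolding cycle_vertex_deletion_eq girth_vertex_deletion_eq deletion_instance
  using satisfiable_imp_girth cycle_imp_satisfiable deletion_mono[of "\<lambda>m. m \<le> l" VV EE "int budget" "\<lambda>m. m = l"]
  by auto

end


section \<open>Computing the instance\<close>

lemma enc_nat_simps [simp]: "enc_nat 0 = Lf" "enc_nat (Suc k) = Br Lf (enc_nat k)"
  by (simp_all add: enc_nat_def)

lemma enc_nat_Lf_iff [simp]: "enc_nat k = Lf \<longleftrightarrow> k = 0"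
  by (cases k) simp_all

section \<open>Arithmetic and enumeration on encoded data\<close>

definition tree_plus :: "nat \<Rightarrow> bintree \<Rightarrow> bintree" where
  "tree_plus k = Br Lf ^^ k"

lemma tree_plus_enc_nat: "tree_plus k (enc_nat m) = enc_nat (m + k)"
  by (induction k) (simp_all add: tree_plus_def)

lemma sz_tree_plus: "sz (tree_plus k t) = sz t + 2 * k"
  by (induction k) (simp_all add: tree_plus_def)

lemma ptime_tree_plus: "ptime f \<Longrightarrow> ptime (\<lambda>x. tree_plus k (f x))"
  by (induction k) (simp_all add: tree_plus_def ptime_Br ptime_Lf)

lemma sz_left_right: "sz (left t) + sz (right t) \<le> sz t + 1"
  by (cases t) simp_all

lemmas ptime_intros = ptime_id ptime_const ptime_left ptime_right ptime_Br ptime_tree_plus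

definition tree_add :: "bintree \<Rightarrow> bintree \<Rightarrow> bintree" where
  "tree_add a b = bfold (\<lambda>x. Br Lf (right x)) a b"

lemma tree_add_enc_nat: "tree_add (enc_nat a) (enc_nat b) = enc_nat (a + b)"
proof -
  have "bfold (\<lambda>x. Br Lf (right x)) (enc_nat a) (enc_nat b) = enc_nat (a + b)" for b
  proof (induction a arbitrary: b)
    case (Suc a)
    from Suc[of "Suc b"] show ?case by simp
  qed simp
  then show ?thesis by (simp add: tree_add_def)
qed

lemma ptime_tree_add: "ptime f \<Longrightarrow> ptime g \<Longrightarrow> ptime (\<lambda>x. tree_add (f x) (g x))"
  unfolding tree_add_def
  by (rule ptime_bfold[where low = "\<lambda>_. Lf" and e = 0 and P = "\<lambda>_. 2"])
    (simp_all add: ptime_Br ptime_right ptime_id ptime_Lf poly_bounded_const)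

text \<open>\<open>next_pair\<close> on pairs whose components are stored doubled, as \<open>num\<close> needs them.\<close>

definition tree_step :: "bintree \<Rightarrow> bintree" where
  "tree_step st = (if right st \<noteq> Lf then Br (tree_plus 2 (left st)) (right (right (right st)))
     else Br Lf (tree_plus 2 (left st)))"

definition enc_pair :: "nat \<times> nat \<Rightarrow> bintree" where
  "enc_pair = (\<lambda>(i, j). Br (enc_nat (2 * i)) (enc_nat (2 * j)))"

lemma tree_step_enc_pair: "tree_step (enc_pair p) = enc_pair (next_pair p)"
  by (cases p rule: next_pair.cases) (simp_all add: tree_step_def enc_pair_def tree_plus_enc_nat)

lemma ptime_tree_step: "ptime f \<Longrightarrow> ptime (\<lambda>x. tree_step (f x))"
  unfolding tree_step_def by (intro ptime_if ptime_intros)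

lemma sz_tree_step: "sz (tree_step st) \<le> sz st + 6"
  using sz_left_right[of st] sz_right_le[of "right st"] sz_right_le[of "right (right st)"] sz_left_le[of st]
  by (cases "right st = Lf") (simp_all add: tree_step_def sz_tree_plus)

text \<open>Two steps per unit, since each variable occupies two consecutive places, one for each
  sign.\<close>

definition tree_pair :: "bintree \<Rightarrow> bintree" where
  "tree_pair v = bfold (\<lambda>x. tree_step (tree_step (right x))) v (Br Lf Lf)"

lemma tree_pair_enc_nat: "tree_pair (enc_nat v) = enc_pair (pair_of (2 * v))"
proof -
  have "bfold (\<lambda>x. tree_step (tree_step (right x))) (enc_nat v) (enc_pair p) = enc_pair ((next_pair ^^ (2 * v)) p)" for p
    by (induction v arbitrary: p) (simp_all add: tree_step_enc_pair funpow_swap1)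
  from this[of "(0, 0)"] show ?thesis by (simp add: tree_pair_def pair_of_def enc_pair_def)
qed

lemma ptime_tree_pair: "ptime f \<Longrightarrow> ptime (\<lambda>x. tree_pair (f x))"
  unfolding tree_pair_def
proof (rule ptime_bfold[where low = "\<lambda>_. Lf" and e = 0 and P = "\<lambda>_. 12"])
  show "sz (tree_step (tree_step (right (Br y acc)))) \<le> sz acc + 12" for y acc
    using sz_tree_step[of "tree_step acc"] sz_tree_step[of acc] by simp
qed (simp_all add: ptime_tree_step ptime_right ptime_id ptime_const poly_bounded_const)

definition tree_pos :: "bintree \<Rightarrow> bintree" where
  "tree_pos x = (if right x \<noteq> Lf then tree_step (tree_pair (left x)) else tree_pair (left x))"

lemma tree_pos_enc_literal: "tree_pos (enc_literal x) = enc_pair (pos x)"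
proof (cases x)
  case (Pair v s)
  then show ?thesis
    by (cases s) (simp_all add: tree_pos_def enc_literal_def enc_bool_def pos_def tree_pair_enc_nat
      tree_step_enc_pair pair_of_def)
qed

lemma ptime_tree_pos: "ptime f \<Longrightarrow> ptime (\<lambda>x. tree_pos (f x))"
  unfolding tree_pos_def by (intro ptime_if ptime_intros ptime_tree_pair ptime_tree_step)

definition tree_enum :: "(bintree \<Rightarrow> bintree) \<Rightarrow> bintree \<Rightarrow> bintree" where
  "tree_enum h m = right (bfold (\<lambda>x. Br (tree_plus 1 (left (right x))) (Br (h (left (right x))) (right (right x)))) m (Br Lf Lf))"

lemma tree_enum_enc_nat: "tree_enum h (enc_nat m) = enc_list (rev (map (\<lambda>i. h (enc_nat i)) [0..<m]))"
proof -
  have "bfold (\<lambda>x. Br (tree_plus 1 (left (right x))) (Br (h (left (right x))) (right (right x)))) (enc_nat m)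
      (Br (enc_nat k) (enc_list (rev (map (\<lambda>i. h (enc_nat i)) [0..<k]))))
    = Br (enc_nat (k + m)) (enc_list (rev (map (\<lambda>i. h (enc_nat i)) [0..<k + m])))" for k
  proof (induction m arbitrary: k)
    case (Suc m)
    from Suc[of "Suc k"] show ?case by (simp add: tree_plus_def)
  qed simp
  from this[of 0] show ?thesis by (simp add: tree_enum_def)
qed

text \<open>Only the counter, the \<open>left\<close> part of the state, is fed into
  \<open>h\<close>. It grows by a constant in each round, so the collected outputs never feed back
  into later ones.\<close>

lemma ptime_tree_enum:
  assumes "ptime h" "ptime f"
  shows "ptime (\<lambda>x. tree_enum h (f x))"
  unfolding tree_enum_def
proof (rule ptime_right, rule ptime_bfold[where low = left and e = 2 and P = "\<lambda>x. sz (h (right x)) + 5"])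
  show "ptime (\<lambda>x. Br (tree_plus 1 (left (right x))) (Br (h (left (right x))) (right (right x))))"
    by (intro ptime_intros ptime_comp[OF assms(1)])
  show "poly_bounded (\<lambda>x. sz (h (right x)) + 5)"
    by (intro poly_bounded_add poly_bounded_const ptime_sz ptime_comp[OF assms(1)] ptime_intros)
  show "sz (Br (tree_plus 1 (left (right (Br y acc)))) (Br (h (left (right (Br y acc)))) (right (right (Br y acc)))))
    \<le> sz acc + (sz (h (right (Br y (left acc)))) + 5)" for y acc
    using sz_left_right[of acc] by (simp add: sz_tree_plus)
qed (simp_all add: assms ptime_const sz_left_le sz_tree_plus)

definition tree_rev :: "bintree \<Rightarrow> bintree" where
  "tree_rev xs = bfold (\<lambda>x. x) xs Lf"

lemma tree_rev_enc_list: "tree_rev (enc_list xs) = enc_list (rev xs)"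
proof -
  have "bfold (\<lambda>x. x) (enc_list xs) (enc_list ys) = enc_list (rev xs @ ys)" for ys
  proof (induction xs arbitrary: ys)
    case (Cons x xs)
    from Cons[of "x # ys"] show ?case by simp
  qed simp
  from this[of "[]"] show ?thesis by (simp add: tree_rev_def)
qed

lemma ptime_tree_rev: "ptime f \<Longrightarrow> ptime (\<lambda>x. tree_rev (f x))"
  unfolding tree_rev_def
  by (rule ptime_bfold[where low = "\<lambda>_. Lf" and e = 0 and P = sz])
    (simp_all add: ptime_id ptime_const poly_bounded_sz)

text \<open>For fixed \<open>l\<close> a gadget has constantly many edges and bag entries, so they
  are emitted by straight-line code with one function per entry.\<close>

definition prepend :: "(bintree \<Rightarrow> bintree) list \<Rightarrow> bintree \<Rightarrow> bintree \<Rightarrow> bintree" where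
  "prepend fs y tail = foldr (\<lambda>f. Br (f y)) fs tail"

lemma prepend_enc_list: "prepend fs y (enc_list ts) = enc_list (map (\<lambda>f. f y) fs @ ts)"
  by (induction fs) (simp_all add: prepend_def)

lemma ptime_prepend:
  assumes "ptime g" "ptime h"
  shows "(\<And>f. f \<in> set fs \<Longrightarrow> ptime f) \<Longrightarrow> ptime (\<lambda>x. prepend fs (g x) (h x))"
proof (induction fs)
  case (Cons f fs)
  have "ptime (\<lambda>x. Br (f (g x)) (prepend fs (g x) (h x)))"
    by (intro ptime_Br ptime_comp[of f g] Cons.IH Cons.prems assms) auto
  then show ?case by (simp add: prepend_def)
qed (simp add: prepend_def assms)

lemma sz_prepend: "sz (prepend fs y t) \<le> sz t + sz (prepend fs y Lf)"
  by (induction fs) (simp_all add: prepend_def)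

text \<open>In the next definitions \<open>y\<close> consists of the literals of a gadget, the number of its first
  private vertex and the list of core vertices.\<close>

fun tree_slot :: "nat \<Rightarrow> slot \<Rightarrow> bintree \<Rightarrow> bintree" where
  "tree_slot l (SU t) y = left (tree_pos (left ((right ^^ t) (left y))))"
| "tree_slot l (SW t) y = tree_plus 1 (right (tree_pos (left ((right ^^ t) (left y)))))"
| "tree_slot l (SX c h) y = tree_plus (c * l + h) (left (right y))"

lemma ptime_funpow_right: "ptime f \<Longrightarrow> ptime (\<lambda>x. (right ^^ t) (f x))"
  by (induction t) (simp_all add: ptime_right)

lemma ptime_tree_slot: "ptime (tree_slot l u)"
proof (cases u)
  case (SU t)
  have "ptime (\<lambda>y. left (tree_pos (left ((right ^^ t) (left y)))))"
    by (intro ptime_intros ptime_tree_pos ptime_funpow_right)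
  then show ?thesis by (simp add: SU tree_slot.simps(1)[abs_def])
next
  case (SW t)
  have "ptime (\<lambda>y. tree_plus 1 (right (tree_pos (left ((right ^^ t) (left y))))))"
    by (intro ptime_intros ptime_tree_pos ptime_funpow_right)
  then show ?thesis by (simp add: SW tree_slot.simps(2)[abs_def])
next
  case (SX c h)
  have "ptime (\<lambda>y. tree_plus (c * l + h) (left (right y)))"
    by (intro ptime_intros)
  then show ?thesis by (simp add: SX tree_slot.simps(3)[abs_def])
qed

definition edge_funs :: "nat \<Rightarrow> nat \<Rightarrow> (bintree \<Rightarrow> bintree) list" where
  "edge_funs l r = map (\<lambda>(u, v) y. Br (tree_slot l u y) (tree_slot l v y)) (template l r)"

definition bag_funs :: "nat \<Rightarrow> (bintree \<Rightarrow> bintree) list" where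
  "bag_funs l = map (\<lambda>d y. tree_plus d (left (right y))) [0..<6 * l]"

lemma ptime_edge_funs: "f \<in> set (edge_funs l r) \<Longrightarrow> ptime f"
  by (auto simp: edge_funs_def intro!: ptime_Br ptime_tree_slot)

lemma ptime_bag_funs: "f \<in> set (bag_funs l) \<Longrightarrow> ptime f"
  by (auto simp: bag_funs_def intro!: ptime_intros)

lemmas ptime_prepend_funs = ptime_prepend[OF _ _ ptime_edge_funs] ptime_prepend[OF _ _ ptime_bag_funs]

text \<open>The state consists of the next free vertex number with the core list on the left, and of
  edges, bags and budget on the right.\<close>

definition tree_emit :: "nat \<Rightarrow> nat \<Rightarrow> bintree \<Rightarrow> bintree" where
  "tree_emit l r x = Br (Br (tree_plus (6 * l) (left (left (right x)))) (right (left (right x))))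
     (Br (prepend (edge_funs l r) (Br (left x) (left (right x))) (left (right (right x))))
       (Br (Br (prepend (bag_funs l) (Br (left x) (left (right x))) (right (left (right x))))
            (left (right (right (right x)))))
         (tree_plus (r - 1) (right (right (right (right x)))))))"

lemma ptime_tree_emit: "ptime (tree_emit l r)"
  unfolding tree_emit_def[abs_def]
  by (intro ptime_intros ptime_prepend_funs)

text \<open>New output is computed from the item and the \<open>left\<close> part alone, and that
  part grows only by \<open>6 * l\<close> unary digits. The extra 2 is slack for malformed trees, on
  which the bounds must hold too.\<close>

lemma ptime_bfold_tree_emit:
  assumes "ptime f" "ptime g"
  shows "ptime (\<lambda>x. bfold (tree_emit l r) (f x) (g x))"
proof (rule ptime_bfold[where low = left and e = "12 * l + 2" and
    P = "\<lambda>y. sz (prepend (edge_funs l r) y Lf) + sz (prepend (bag_funs l) y (right (right y))) + (12 * l + 2 * r + 12)"])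
  show "poly_bounded (\<lambda>y. sz (prepend (edge_funs l r) y Lf) + sz (prepend (bag_funs l) y (right (right y))) + (12 * l + 2 * r + 12))"
    by (intro poly_bounded_add poly_bounded_const ptime_sz ptime_intros ptime_prepend_funs)
  show "sz (left (tree_emit l r (Br y acc))) \<le> sz (left acc) + (12 * l + 2)" for y acc
    using sz_left_right[of "left acc"] by (simp add: tree_emit_def sz_tree_plus)
  show "sz (tree_emit l r (Br y acc)) \<le> sz acc +
     (sz (prepend (edge_funs l r) (Br y (left acc)) Lf) +
      sz (prepend (bag_funs l) (Br y (left acc)) (right (right (Br y (left acc))))) + (12 * l + 2 * r + 12))" for y acc
    using sz_left_right[of acc] sz_left_right[of "left acc"] sz_left_right[of "right acc"]
      sz_left_right[of "right (right acc)"]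
      sz_prepend[of "edge_funs l r" "Br y (left acc)" "left (right acc)"]
    by (simp add: tree_emit_def sz_tree_plus)
qed (auto intro: assms ptime_tree_emit simp: sz_left_le)

definition tree_core_size :: "bintree \<Rightarrow> bintree" where
  "tree_core_size m = tree_add (left (tree_pair m)) (tree_plus 2 (right (tree_pair m)))"

definition tree_variable :: "bintree \<Rightarrow> bintree" where
  "tree_variable v = Br (Br v Lf) (Br (Br v (Br Lf Lf)) Lf)"

definition tree_start :: "bintree \<Rightarrow> bintree" where
  "tree_start m = Br (Br (tree_core_size m) (tree_enum (\<lambda>x. x) (tree_core_size m)))
     (Br Lf (Br (Br (tree_enum (\<lambda>x. x) (tree_core_size m)) Lf) Lf))"

text \<open>The inner fold treats the variables, the outer one the clauses. \<open>tree_enum\<close>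
  lists in descending order, hence the reversal.\<close>

definition tree_gadgets :: "nat \<Rightarrow> bintree \<Rightarrow> bintree" where
  "tree_gadgets l x = bfold (tree_emit l 3) (right x)
     (bfold (tree_emit l 2) (tree_rev (tree_enum tree_variable (left x))) (tree_start (left x)))"

text \<open>After the last gadget the next free number is the number of vertices; the
  \<open>Lf\<close> before the budget is the sign bit of \<open>enc_int\<close>.\<close>

definition tree_output :: "bintree \<Rightarrow> bintree" where
  "tree_output st = Br (left (left st)) (Br (left (right st))
     (Br (Br Lf (right (right (right st)))) (Br (left (right (right st))) Lf)))"

lemma ptime_reduction: "ptime (\<lambda>x. tree_output (tree_gadgets l x))"
proof -
  have "ptime tree_variable" unfolding tree_variable_def[abs_def] by (intro ptime_intros)
  moreover have "ptime tree_core_size"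
    unfolding tree_core_size_def[abs_def] by (intro ptime_intros ptime_tree_add ptime_tree_pair)
  then have "ptime tree_start"
    unfolding tree_start_def[abs_def] by (intro ptime_intros ptime_tree_enum)
  from ptime_comp[OF this ptime_left0] have "ptime (\<lambda>x. tree_start (left x))" .
  ultimately have "ptime (tree_gadgets l)"
    unfolding tree_gadgets_def[abs_def]
    by (intro ptime_bfold_tree_emit ptime_tree_rev ptime_tree_enum ptime_intros)
  moreover have "ptime tree_output"
    unfolding tree_output_def[abs_def] by (intro ptime_intros)
  ultimately show ?thesis by (rule ptime_comp[rotated])
qed

context reduction begin

text \<open>The loop invariant: the tree held after \<open>g\<close> gadgets.\<close>

definition state :: "nat \<Rightarrow> bintree" where
  "state g = Br (Br (enc_nat (2 * M + 6 * l * g)) (enc_list (map enc_nat core)))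
     (Br (enc_list (map (\<lambda>(u, v). Br (enc_nat u) (enc_nat v)) (edge_list g)))
       (Br (enc_list (map (\<lambda>b. enc_list (map enc_nat b)) (bag_list g))) (enc_nat (\<Sum>i<g. q i - 1))))"

lemma tree_slot_num:
  assumes "u \<in> {SU t, SW t} \<Longrightarrow> t < length xs" and "\<exists>c h. u \<in> {SU t, SW t, SX c h}"
  shows "tree_slot l u (Br (enc_list (map enc_literal xs)) (Br (enc_nat (2 * M + 6 * l * g)) z)) =
    enc_nat (num (inst g xs u))"
proof -
  have nth: "left ((right ^^ t) (enc_list ts)) = ts ! t" if "t < length ts" for ts t
    using that
  proof (induction ts arbitrary: t)
    case (Cons a ts)
    then show ?case by (cases t) (simp_all add: funpow_swap1)
  qed simp
  show ?thesis
    using assms nth[of t "map enc_literal xs"]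
    by (auto simp: tree_pos_enc_literal enc_pair_def case_prod_beta tree_plus_enc_nat)
qed

lemma tree_emit_state:
  assumes g: "g < n + length cs"
  shows "tree_emit l (q g) (Br (enc_list (map enc_literal (gadgets (n, cs) ! g))) (state g)) = state (Suc g)"
proof -
  let ?xs = "gadgets (n, cs) ! g"
  let ?y = "Br (enc_list (map enc_literal ?xs)) (Br (enc_nat (2 * M + 6 * l * g)) (enc_list (map enc_nat core)))"
  have slots: "tree_slot l u ?y = enc_nat (num (inst g ?xs u)) \<and> tree_slot l v ?y = enc_nat (num (inst g ?xs v))"
    if "(u, v) \<in> set (template l (q g))" for u v
  proof -
    have *: "\<exists>t. (u \<in> {SU t, SW t} \<longrightarrow> t < q g) \<and> (\<exists>c h. u \<in> {SU t, SW t, SX c h}) \<and> (\<exists>c h. v = SX c h)"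
      using that unfolding mem_template by (elim disjE exE conjE) auto
    then obtain t where t: "u \<in> {SU t, SW t} \<longrightarrow> t < q g" "\<exists>c h. u \<in> {SU t, SW t, SX c h}" "\<exists>c h. v = SX c h"
      by blast
    show ?thesis
      using tree_slot_num[of u t ?xs g] tree_slot_num[of v t ?xs g] t by blast
  qed
  have edges: "map (\<lambda>f. f ?y) (edge_funs l (q g)) =
      map (\<lambda>(u, v). Br (enc_nat u) (enc_nat v)) (map (map_prod num num) (gadget_edges g))"
    unfolding edge_funs_def gadget_edges_def using slots by (auto simp: comp_def)
  have bags: "map (\<lambda>f. f ?y) (bag_funs l) = map enc_nat (map (\<lambda>d. 2 * M + 6 * l * g + d) [0..<6 * l])"
    by (simp add: bag_funs_def tree_plus_enc_nat comp_def)
  have "edge_list (Suc g) = map (map_prod num num) (gadget_edges g) @ edge_list g"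
    "bag_list (Suc g) = (map (\<lambda>d. 2 * M + 6 * l * g + d) [0..<6 * l] @ core) # bag_list g"
    by (simp_all add: edge_list_def bag_list_def bag_def)
  moreover have "2 * M + 6 * l * Suc g = 2 * M + 6 * l * g + 6 * l" by simp
  ultimately show ?thesis
    unfolding tree_emit_def state_def left.simps right.simps prepend_enc_list edges bags tree_plus_enc_nat
    by (simp only: map_append enc_list.simps list.map sum.lessThan_Suc)
qed

lemma bfold_tree_emit:
  assumes "\<And>i. i < length xss \<Longrightarrow> gadgets (n, cs) ! (g + i) = xss ! i \<and> length (xss ! i) = r"
    "g + length xss \<le> n + length cs"
  shows "bfold (tree_emit l r) (enc_list (map (\<lambda>xs. enc_list (map enc_literal xs)) xss)) (state g) =
    state (g + length xss)"
  using assms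
proof (induction xss arbitrary: g)
  case (Cons xs xss)
  have "gadgets (n, cs) ! g = xs" "length xs = r" using Cons.prems(1)[of 0] by auto
  with tree_emit_state[of g] Cons.prems(2)
  have "tree_emit l r (Br (enc_list (map enc_literal xs)) (state g)) = state (Suc g)" by simp
  moreover have "bfold (tree_emit l r) (enc_list (map (\<lambda>xs. enc_list (map enc_literal xs)) xss)) (state (Suc g)) =
    state (Suc g + length xss)"
    by (rule Cons.IH) (use Cons.prems(1)[of "Suc _"] Cons.prems(2) in auto)
  ultimately show ?case by simp
qed simp

lemma reduction_correct:
  "tree_output (tree_gadgets l (enc_cnf3 (n, cs))) = enc_pd_instance instance_of"
proof -
  let ?v = "\<lambda>v. [(v, False), (v, True)] :: literal list"
  have size: "tree_core_size (enc_nat n) = enc_nat (2 * M)"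
    by (simp add: tree_core_size_def tree_pair_enc_nat enc_pair_def case_prod_beta tree_plus_enc_nat
        tree_add_enc_nat M_def diag_def algebra_simps del: enc_nat_simps)
  have "tree_start (enc_nat n) = state 0"
    by (simp add: tree_start_def size state_def tree_enum_enc_nat core_def edge_list_def bag_list_def rev_map)
  moreover have "tree_rev (tree_enum tree_variable (enc_nat n)) =
      enc_list (map (\<lambda>xs. enc_list (map enc_literal xs)) (map ?v [0..<n]))"
    by (simp add: tree_enum_enc_nat tree_rev_enc_list tree_variable_def enc_literal_def enc_bool_def comp_def)
  moreover have "bfold (tree_emit l 2) (enc_list (map (\<lambda>xs. enc_list (map enc_literal xs)) (map ?v [0..<n]))) (state 0) = state (0 + length (map ?v [0..<n]))"
    by (rule bfold_tree_emit) (auto simp: gadgets_var)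
  moreover have "map enc_clause cs = map (\<lambda>xs. enc_list (map enc_literal xs)) (map (\<lambda>(x, y, z). [x, y, z]) cs)"
    by (auto simp: enc_clause_def)
  moreover have "bfold (tree_emit l 3) (enc_list (map (\<lambda>xs. enc_list (map enc_literal xs)) (map (\<lambda>(x, y, z). [x, y, z]) cs))) (state n) = state (n + length (map (\<lambda>(x, y, z). [x, y, z]) cs))"
    by (rule bfold_tree_emit) (auto simp: gadgets_clause split: prod.splits)
  ultimately have "tree_gadgets l (enc_cnf3 (n, cs)) = state (n + length cs)"
    by (simp add: tree_gadgets_def enc_cnf3_def del: map_map)
  moreover have "enc_int (int budget) = Br Lf (enc_nat (\<Sum>i<n + length cs. q i - 1))"
    by (simp only: enc_int_def enc_bool_def budget_def length_gadgets nat_int abs_of_nat if_False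
        of_nat_less_0_iff)
  ultimately show ?thesis
    by (simp add: tree_output_def state_def enc_pd_instance_def instance_of_def)
qed

end

text \<open>Variables are written in unary, and validity bounds each of them by \<open>n\<close>;
  this makes the size quadratic and turns bounds in \<open>sz\<close> into bounds in
  \<open>n + length cs + 1\<close>.\<close>

lemma sz_enc_cnf3:
  assumes "valid_cnf3 (n, cs)"
  shows "sz (enc_cnf3 (n, cs)) \<le> 20 * (n + length cs + 1) ^ 2"
proof -
  have nat: "sz (enc_nat k) = 2 * k + 1" for k by (induction k) simp_all
  have lit: "sz (enc_literal (v, s)) \<le> 2 * n + 3" if "v < n" for v s
    using that by (simp add: enc_literal_def enc_bool_def nat)
  have clause: "sz (enc_clause c) \<le> 6 * n + 13" if "c \<in> set cs" for c
  proof -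
    obtain u a v b w d where c: "c = ((u, a), (v, b), (w, d))" by (metis prod.exhaust)
    with that assms have "u < n" "v < n" "w < n" by (auto simp: valid_cnf3_def)
    with lit[of u a] lit[of v b] lit[of w d] show ?thesis by (simp add: c enc_clause_def)
  qed
  have "sz (enc_list (map enc_clause ds)) \<le> length ds * (6 * n + 14) + 1" if "set ds \<subseteq> set cs" for ds
    using that
  proof (induction ds)
    case (Cons d ds)
    then show ?case using clause[of d] by simp
  qed simp
  from this[of cs] have "sz (enc_cnf3 (n, cs)) \<le> 2 * n + 3 + length cs * (6 * n + 14)"
    by (simp add: enc_cnf3_def nat)
  also have "\<dots> \<le> 20 * (n + length cs + 1) ^ 2"
    by (simp add: power2_eq_square algebra_simps)
  finally show ?thesis .
qed

context reduction begin

lemma graph_size_bound: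
  "graph_size {..<2 * M + 6 * l * (n + length cs)} (edges_of (edge_list (n + length cs))) + 1
     \<le> (7 + 6 * l + length (template l 2) + length (template l 3)) * (n + length cs + 1)"
proof -
  let ?\<tau> = "length (template l 2) + length (template l 3)"
  have "length (edge_list m) \<le> m * ?\<tau>" if "m \<le> n + length cs" for m
    using that
  proof (induction m)
    case (Suc m)
    then have "length (gadget_edges m) \<le> ?\<tau>" by (simp add: gadget_edges_def length_gadgets_nth)
    with Suc show ?case by (simp add: edge_list_def)
  qed (simp add: edge_list_def)
  then have "length (edge_list (n + length cs)) \<le> (n + length cs) * ?\<tau>" by blast
  moreover have "card (edges_of (edge_list (n + length cs))) \<le> length (edge_list (n + length cs))"
    unfolding edges_of_def by (rule order_trans[OF card_image_le card_length]) simp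
  ultimately show ?thesis using M_bound(1) by (simp add: graph_size_def algebra_simps)
qed

text \<open>By \<open>(x + y) ^ 2 <= 2 * x ^ 2 + 2 * y ^ 2\<close> with
  \<open>x = 2 * (M - 1)\<close>: here \<open>2 * x ^ 2 = 8 * (M - 1) ^ 2 <= 32 * n\<close>, while
  the other summand depends on \<open>l\<close> only.\<close>

lemma pd_width_square:
  "(pd_width (map set (bag_list (n + length cs))))\<^sup>2 \<le> 32 * n + 2 * (6 * l + 2)\<^sup>2"
proof -
  have M: "2 * M + 6 * l = 2 * (M - 1) + (6 * l + 2)" by (simp add: M_def)
  have sq: "(x + y)\<^sup>2 \<le> 2 * x\<^sup>2 + 2 * y\<^sup>2" for x y :: nat
  proof -
    have "(int x + int y)\<^sup>2 + (int x - int y)\<^sup>2 = 2 * (int x)\<^sup>2 + 2 * (int y)\<^sup>2"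
      by (simp add: power2_eq_square algebra_simps)
    then have "(int x + int y)\<^sup>2 \<le> 2 * (int x)\<^sup>2 + 2 * (int y)\<^sup>2"
      using zero_le_power2[of "int x - int y"] by linarith
    then show ?thesis by (metis (mono_tags) of_nat_add of_nat_le_iff of_nat_mult of_nat_numeral of_nat_power)
  qed
  have "(pd_width (map set (bag_list (n + length cs))))\<^sup>2 \<le> (2 * M + 6 * l)\<^sup>2"
    by (rule power_mono[OF pd_width_instance]) simp
  also have "\<dots> \<le> 2 * (2 * (M - 1))\<^sup>2 + 2 * (6 * l + 2)\<^sup>2"
    unfolding M by (rule sq)
  also have "2 * (2 * (M - 1))\<^sup>2 \<le> 32 * n"
    using M_bound(2) by (simp add: power_mult_distrib)
  finally show ?thesis by simp
qed

end

lemma subexp_bound: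
  assumes f: "f \<in> o(\<lambda>p. real p ^ 2)" and c: "c > 1"
  obtains A where "A > 0" "\<And>p n. p\<^sup>2 \<le> 32 * n + B \<Longrightarrow> 2 powr f p \<le> A * c ^ n"
proof -
  \<comment> \<open>Chosen so that \<open>\<epsilon> * 32 * n\<close> is exactly
    \<open>log 2 c * n\<close>. The finitely many \<open>p\<close> below the threshold of the
    little-o bound are absorbed by the constant \<open>D\<close>.\<close>
  define \<epsilon> where "\<epsilon> = log 2 c / 32"
  have \<epsilon>: "\<epsilon> > 0" using c by (simp add: \<epsilon>_def)
  from landau_o.smallD[OF f this] obtain p0 where p0: "\<And>p. p \<ge> p0 \<Longrightarrow> \<bar>f p\<bar> \<le> \<epsilon> * real p ^ 2"
    by (auto simp: eventually_at_top_linorder)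
  define D where "D = (\<Sum>p<p0. \<bar>f p\<bar>)"
  have D: "\<bar>f p\<bar> \<le> D" if "p < p0" for p
    unfolding D_def by (rule member_le_sum) (use that in auto)
  have fD: "f p \<le> D + \<epsilon> * real p ^ 2" for p
  proof (cases "p < p0")
    case True
    have "0 \<le> \<epsilon> * real p ^ 2" using \<epsilon> by simp
    with D[OF True] show ?thesis by linarith
  next
    case False
    have "0 \<le> D" unfolding D_def by (rule sum_nonneg) simp
    with p0[of p] False show ?thesis by linarith
  qed
  show thesis
  proof
    show "2 powr (D + \<epsilon> * real B) > 0" by simp
    fix p n :: nat assume p: "p\<^sup>2 \<le> 32 * n + B"
    have "real (p\<^sup>2) \<le> real (32 * n + B)" using p of_nat_le_iff by blast
    then have "\<epsilon> * real p ^ 2 \<le> \<epsilon> * (32 * real n + real B)" using \<epsilon> by (intro mult_left_mono) auto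
    also have "\<dots> = log 2 c * real n + \<epsilon> * real B" by (simp add: \<epsilon>_def algebra_simps)
    finally have "f p \<le> (D + \<epsilon> * real B) + log 2 c * real n" using fD[of p] by linarith
    then have "2 powr f p \<le> 2 powr ((D + \<epsilon> * real B) + log 2 c * real n)" by simp
    also have "\<dots> = 2 powr (D + \<epsilon> * real B) * (2 powr log 2 c) powr real n"
      by (simp only: powr_add powr_powr)
    also have "(2 powr log 2 c) powr real n = c ^ n" using c by (simp add: powr_realpow)
    finally show "2 powr f p \<le> 2 powr (D + \<epsilon> * real B) * c ^ n" .
  qed
qed

lemma sat3_of_deletion:
  assumes l: "l \<ge> 5" and c: "c > 1" and solv: "solvable_in_subexp_pd_time problem"
    and correct: "\<And>n cs. valid_cnf3 (n, cs) \<Longrightarrow>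
      (case reduction.instance_of l n cs of (m, es, k, bs) \<Rightarrow> problem {..<m} (edges_of es) k) \<longleftrightarrow> satisfiable_cnf3 (n, cs)"
  shows "sat3_exponential_base c"
proof -
  obtain P f C d where f: "f \<in> o(\<lambda>p. real p ^ 2)" and P: "solves_in_time P enc_pd_instance {x. valid_pd_instance x}
          (\<lambda>(n, es, k, bs). problem {..<n} (edges_of es) k)
          (\<lambda>(n, es, k, bs). C * 2 powr f (pd_width (map set bs)) *
             real (graph_size {..<n} (edges_of es) + 1) ^ d)"
    using solv unfolding solvable_in_subexp_pd_time_def by blast
  let ?red = "\<lambda>x. tree_output (tree_gadgets l x)"
  obtain R N T where T: "poly_bounded T" and R: "computes R N T ?red"
    by (rule ptimeE[OF ptime_reduction])
  obtain K e where K: "\<And>x. T x \<le> K * sz x ^ e" using T unfolding poly_bounded_def by blast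
  obtain A where A: "A > 0" "\<And>p n. p\<^sup>2 \<le> 32 * n + 2 * (6 * l + 2)\<^sup>2 \<Longrightarrow> 2 powr f p \<le> A * c ^ n"
    using subexp_bound[OF f c] by blast
  define K1 where "K1 = K * 20 ^ e"
  define K2 where "K2 = 7 + 6 * l + length (template l 2) + length (template l 3)"
  define C1 where "C1 = real K1 + \<bar>C\<bar> * A * real K2 ^ d"
  have "solves_in_time (Seq R P) enc_cnf3 {\<phi>. valid_cnf3 \<phi>} satisfiable_cnf3
          (\<lambda>(n, cs). C1 * c ^ n * real (n + length cs + 1) ^ (2 * e + d))"
    unfolding solves_in_time_def
  proof (intro ballI)
    fix \<phi> :: cnf3 assume "\<phi> \<in> {\<phi>. valid_cnf3 \<phi>}"
    moreover obtain n cs where \<phi>: "\<phi> = (n, cs)" by (cases \<phi>)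
    ultimately have valid: "valid_cnf3 (n, cs)" by simp
    interpret reduction l n cs by unfold_locales (use l valid in auto)
    let ?s = "n + length cs + 1"
    let ?x = "enc_cnf3 (n, cs)"
    \<comment> \<open>The reduction restores its scratch variables, so the given solver starts in
      exactly the initial store that it expects.\<close>
    obtain t where t: "t \<le> T ?x" "run R (init ?x) t (init (?red ?x))"
    proof -
      have "init ?x 0 = ?x" "init (?red ?x) = (init ?x)(0 := ?red ?x)" "\<And>i. 0 < i \<Longrightarrow> init ?x i = Lf"
        by (simp_all add: init_def fun_eq_iff)
      with computes_run[OF R, of "init ?x" "init (?red ?x)"] that show thesis by auto
    qed
    obtain u s where u: "run P (init (enc_pd_instance instance_of)) u s"
      "real u \<le> C * 2 powr f (pd_width (map set (bag_list (n + length cs)))) *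
         real (graph_size {..<2 * M + 6 * l * (n + length cs)} (edges_of (edge_list (n + length cs))) + 1) ^ d"
      "s 0 \<noteq> Lf \<longleftrightarrow> (case instance_of of (m, es, k, bs) \<Rightarrow> problem {..<m} (edges_of es) k)"
      using P valid_instance unfolding solves_in_time_def instance_of_def by fastforce
    have "run (Seq R P) (init ?x) (t + u) s"
      using t(2) u(1) unfolding reduction_correct by (rule run.Seq)
    moreover have "real (t + u) \<le> C1 * c ^ n * real ?s ^ (2 * e + d)"
    proof -
      have "t \<le> K1 * ?s ^ (2 * e)"
      proof -
        have "t \<le> K * sz ?x ^ e" using t(1) K order_trans by blast
        also have "\<dots> \<le> K * (20 * ?s ^ 2) ^ e"
          by (intro mult_left_mono power_mono sz_enc_cnf3[OF valid]) auto
        finally show ?thesis by (simp add: K1_def power_mult_distrib power_mult mult.assoc)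
      qed
      then have "real t \<le> real K1 * real ?s ^ (2 * e)"
        by (metis of_nat_le_iff of_nat_mult of_nat_power)
      also have "\<dots> \<le> real K1 * (c ^ n * real ?s ^ (2 * e + d))"
      proof (rule mult_left_mono)
        have "1 * real ?s ^ (2 * e) \<le> c ^ n * real ?s ^ (2 * e + d)"
          using c by (intro mult_mono power_increasing one_le_power) auto
        then show "real ?s ^ (2 * e) \<le> c ^ n * real ?s ^ (2 * e + d)" by simp
      qed simp
      finally have 1: "real t \<le> real K1 * (c ^ n * real ?s ^ (2 * e + d))" .
      let ?g = "graph_size {..<2 * M + 6 * l * (n + length cs)} (edges_of (edge_list (n + length cs))) + 1"
      let ?p = "pd_width (map set (bag_list (n + length cs)))"
      have "real ?g \<le> real K2 * real ?s"
        using graph_size_bound unfolding K2_def[symmetric] by (metis of_nat_le_iff of_nat_mult)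
      then have g: "real ?g ^ d \<le> (real K2 * real ?s) ^ d" by (rule power_mono) simp
      \<comment> \<open>Nothing guarantees \<open>C >= 0\<close>, so monotonicity arguments need the
        absolute value.\<close>
      have "C * 2 powr f ?p * real ?g ^ d \<le> \<bar>C\<bar> * 2 powr f ?p * real ?g ^ d"
        by (intro mult_right_mono) auto
      also have "\<dots> \<le> \<bar>C\<bar> * (A * c ^ n) * (real K2 * real ?s) ^ d"
        using A(1) c by (intro mult_mono g A(2) pd_width_square order_refl mult_nonneg_nonneg) auto
      also have "\<dots> = \<bar>C\<bar> * A * real K2 ^ d * (c ^ n * real ?s ^ d)"
        by (simp add: power_mult_distrib mult.assoc mult.left_commute)
      also have "\<dots> \<le> \<bar>C\<bar> * A * real K2 ^ d * (c ^ n * real ?s ^ (2 * e + d))"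
        using A(1) c by (intro mult_left_mono power_increasing) auto
      finally have "real u \<le> \<bar>C\<bar> * A * real K2 ^ d * (c ^ n * real ?s ^ (2 * e + d))"
        using u(2) by linarith
      with 1 show ?thesis by (simp add: C1_def distrib_right mult.assoc)
    qed
    moreover have "s 0 \<noteq> Lf \<longleftrightarrow> satisfiable_cnf3 (n, cs)"
      using u(3) correct[OF valid] by simp
    ultimately show "\<exists>t s. run (Seq R P) (init (enc_cnf3 \<phi>)) t s \<and>
        real t \<le> (case \<phi> of (n, cs) \<Rightarrow> C1 * c ^ n * real (n + length cs + 1) ^ (2 * e + d)) \<and>
        (s 0 \<noteq> Lf \<longleftrightarrow> satisfiable_cnf3 \<phi>)"
      unfolding \<phi> prod.case by blast
  qed
  then show ?thesis unfolding sat3_exponential_base_def by blast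
qed

theorem theorem3:
  fixes l :: nat
  assumes "l \<ge> 5" and "ETH"
  shows "\<not> solvable_in_subexp_pd_time (cycle_vertex_deletion l) \<and>
         \<not> solvable_in_subexp_pd_time (girth_vertex_deletion l)"
proof -
  have "\<not> solvable_in_subexp_pd_time problem"
    if correct: "\<And>n cs. valid_cnf3 (n, cs) \<Longrightarrow>
      (case reduction.instance_of l n cs of (m, es, k, bs) \<Rightarrow> problem {..<m} (edges_of es) k) \<longleftrightarrow> satisfiable_cnf3 (n, cs)"
    for problem :: "nat set \<Rightarrow> nat set set \<Rightarrow> int \<Rightarrow> bool"
  proof
    assume solv: "solvable_in_subexp_pd_time problem"
    \<comment> \<open>Every base above 1 belongs to the set, which is bounded below by 0, so the
      infimum is at most 1.\<close>
    have "Inf {c :: real. 0 < c \<and> sat3_exponential_base c} \<le> c" if "c > 1" for c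
      using sat3_of_deletion[OF assms(1) that solv correct] that
      by (intro cInf_lower bdd_belowI[of _ 0]) auto
    then have "Inf {c :: real. 0 < c \<and> sat3_exponential_base c} \<le> 1" by (rule dense_ge)
    with assms(2) show False unfolding ETH_def by simp
  qed
  moreover have "(case reduction.instance_of l n cs of (m, es, k, bs) \<Rightarrow>
        cycle_vertex_deletion l {..<m} (edges_of es) k) \<longleftrightarrow> satisfiable_cnf3 (n, cs)"
      "(case reduction.instance_of l n cs of (m, es, k, bs) \<Rightarrow>
        girth_vertex_deletion l {..<m} (edges_of es) k) \<longleftrightarrow> satisfiable_cnf3 (n, cs)"
    if "valid_cnf3 (n, cs)" for n cs
  proof -
    interpret reduction l n cs by unfold_locales (use assms(1) that in auto)
    show "(case reduction.instance_of l n cs of (m, es, k, bs) \<Rightarrow>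
        cycle_vertex_deletion l {..<m} (edges_of es) k) \<longleftrightarrow> satisfiable_cnf3 (n, cs)"
      "(case reduction.instance_of l n cs of (m, es, k, bs) \<Rightarrow>
        girth_vertex_deletion l {..<m} (edges_of es) k) \<longleftrightarrow> satisfiable_cnf3 (n, cs)"
      using solution_iff by (simp_all add: instance_of_def)
  qed
  ultimately show ?thesis by blast
qed

end
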